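(* Let $\mathcal P$ be a finite chiral polytope. If $|\Gamma^+(\mathcal P) \mathbin{\square} \Gamma^+(\mathcal P^{\delta})| > |\Gamma^+(\mathcal P) \mathbin{\square} \Gamma^+(\overline{\mathcal P})|$, then $\mathcal P \diamond \mathcal P^{\delta}$ is chiral.
   Context: An abstract polytope of rank $n$ (an $n$-polytope) is a ranked poset of faces with ranks from $-1$ to $n$, with a unique least face (rank $-1$) and a unique greatest face (rank $n$), in which every flag (maximal chain) has $n+2$ faces, which satisfies the diamond condition (whenever $F<G$ with ranks $j-1$ and $j+1$ there are exactly two $j$-faces strictly between them), and which is strongly flag-connected (any two flags $\Phi,\Psi$ are joined by a sequence of flags, consecutive ones adjacent, all containing $\Phi\cap\Psi$; two flags are adjacent if they differ in exactly one face). $\Phi^j$ denotes the unique flag differing from $\Phi$ only in its $j$-face, and $\Phi^{i,j}=(\Phi^i)^j$. Each polytope considered has a fixed base flag $\Phi$. $\mathcal P$ is chiral if its automorphism group $\Gamma(\mathcal P)$ has exactly two orbits on flags and adjacent flags lie in distinct orbits; then $\Gamma^+(\mathcal P):=\Gamma(\mathcal P)$ is generated by $\sigma_1,\dots,\sigma_{n-1}$, where $\sigma_i$ maps $\Phi$ to $\Phi^{i,i-1}$. One has $(\sigma_i\cdots\sigma_j)^2=1$ for $i<j$. Let $W^+=\langle \sigma_1,\dots,\sigma_{n-1}\mid (\sigma_i\cdots\sigma_j)^2=1 \text{ for } 1\le i<j\le n-1\rangle$. Writing $\Gamma^+(\mathcal P)=W^+/M$ means that $M$ is the kernel of the epimorphism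 $W^+\to\Gamma^+(\mathcal P)$ preserving the specified generators. For $w\in W^+$, $\overline w$ is obtained by replacing $\sigma_1$ by $\sigma_1^{-1}$, $\sigma_2$ by $\sigma_1^2\sigma_2$ and fixing $\sigma_j$ for $j\ge3$; $\delta(w)$ is obtained by replacing each $\sigma_i$ by $\sigma_{n-i}^{-1}$ (both are automorphisms of $W^+$). Put $\overline M=\{\overline w:w\in M\}$, $\delta(M)=\{\delta(w):w\in M\}$. If $\Gamma^+(\mathcal P)=W^+/M$ with $\mathcal P$ chiral, then $\overline M\ne M$; the mirror image $\overline{\mathcal P}$ (same faces, base flag $\Phi^0$) has $\Gamma^+(\overline{\mathcal P})=W^+/\overline M$, and the dual $\mathcal P^\delta$ (reversed order) has $\Gamma^+(\mathcal P^\delta)=W^+/\delta(M)$. Mix and comix: for groups with specified generators $\Gamma=\langle x_1,\dots,x_k\mid R\rangle$, $\Gamma'=\langle x_1',\dots,x_k'\mid S\rangle$, the mix $\Gamma\diamond\Gamma'$ is the subgroup of $\Gamma\times\Gamma'$ generated by $(x_i,x_i')$, $i=1,\dots,k$, and the comix $\Gamma\mathbin{\square}\Gamma'$ is the group $\langle x_1,x_1',\dots,x_k,x_k'\mid R,S,x_1^{-1}x_1',\dots,x_k^{-1}x_k'\rangle$. $\mathcal P\diamond\mathcal Q$ is the flag-connected pre-polytope (polytope axioms with strong flag-connectedness weakened to flag-connectedness) built from $\Gamma^+(\mathcal P)\diamond\Gamma^+(\mathcal Q)$; it is handled through $\Gamma^+(\mathcal P\diamond\mathcal Q)=\Gamma^+(\mathcal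 P)\diamond\Gamma^+(\mathcal Q)=W^+/N$, and it is directly regular if $\overline N=N$ and chiral if $\overline N\ne N$ (it need not be polytopal). *)

theory Defs
  imports "HOL-Algebra.Group_Action" "HOL-Algebra.Generated_Groups"
begin

record 'a based_poset =
  faces :: "'a set"
  face_le :: "'a rel"
  face_rank :: "'a \<Rightarrow> int"
  base :: "'a set"

definition flags :: "('a, 'm) based_poset_scheme \<Rightarrow> 'a set set" where
  "flags P = {C \<in> Chains (face_le P). \<forall>D \<in> Chains (face_le P). C \<subseteq> D \<longrightarrow> D = C}"

definition adjacent :: "('a, 'm) based_poset_scheme \<Rightarrow> 'a set \<Rightarrow> 'a set \<Rightarrow> bool" where
  "adjacent P \<Phi> \<Psi> \<longleftrightarrow>
     \<Phi> \<in> flags P \<and> \<Psi> \<in> flags P \<and> card (\<Phi> - \<Psi>) = 1 \<and> card (\<Psi> - \<Phi>) = 1"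

definition adj_flag :: "('a, 'm) based_poset_scheme \<Rightarrow> int \<Rightarrow> 'a set \<Rightarrow> 'a set" where
  "adj_flag P j \<Phi> = (THE \<Psi>. \<Psi> \<in> flags P \<and> \<Psi> \<noteq> \<Phi> \<and>
     {F \<in> \<Psi>. face_rank P F \<noteq> j} = {F \<in> \<Phi>. face_rank P F \<noteq> j})"

definition ranked_bounded :: "nat \<Rightarrow> ('a, 'm) based_poset_scheme \<Rightarrow> bool" where
  "ranked_bounded n P \<longleftrightarrow>
     partial_order_on (faces P) (face_le P) \<and>
     (\<forall>F \<in> faces P. -1 \<le> face_rank P F \<and> face_rank P F \<le> int n) \<and>
     (\<forall>F G. (F, G) \<in> face_le P \<and> F \<noteq> G \<longrightarrow> face_rank P F < face_rank P G) \<and>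
     (\<exists>F \<in> faces P. face_rank P F = -1 \<and> (\<forall>G \<in> faces P. (F, G) \<in> face_le P)) \<and>
     (\<exists>F \<in> faces P. face_rank P F = int n \<and> (\<forall>G \<in> faces P. (G, F) \<in> face_le P))"

definition diamond_condition :: "('a, 'm) based_poset_scheme \<Rightarrow> bool" where
  "diamond_condition P \<longleftrightarrow>
     (\<forall>F G j. (F, G) \<in> face_le P \<and> face_rank P F = j - 1 \<and> face_rank P G = j + 1 \<longrightarrow>
        card {H \<in> faces P. face_rank P H = j \<and> (F, H) \<in> face_le P \<and> (H, G) \<in> face_le P} = 2)"

definition strongly_flag_connected :: "('a, 'm) based_poset_scheme \<Rightarrow> bool" where
  "strongly_flag_connected P \<longleftrightarrow>
     (\<forall>\<Phi> \<in> flags P. \<forall>\<Psi> \<in> flags P.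
        (\<Phi>, \<Psi>) \<in> {(A, B). adjacent P A B \<and> \<Phi> \<inter> \<Psi> \<subseteq> A \<and> \<Phi> \<inter> \<Psi> \<subseteq> B}\<^sup>*)"

definition abstract_polytope :: "nat \<Rightarrow> ('a, 'm) based_poset_scheme \<Rightarrow> bool" where
  "abstract_polytope n P \<longleftrightarrow>
     ranked_bounded n P \<and>
     (\<forall>\<Phi> \<in> flags P. card \<Phi> = n + 2) \<and>
     diamond_condition P \<and>
     strongly_flag_connected P \<and>
     base P \<in> flags P"

(* Automorphisms act on the right: the product f g means "first f, then g".  With
   sigma_i mapping the base flag Phi to Phi^{i,i-1}, this is the convention under which
   the relations (sigma_i ... sigma_j)^2 = 1 hold. *)
definition aut_group :: "('a, 'm) based_poset_scheme \<Rightarrow> ('a \<Rightarrow> 'a) monoid" where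
  "aut_group P =
     \<lparr>carrier = {f \<in> Bij (faces P). \<forall>F \<in> faces P. \<forall>G \<in> faces P.
                   (f F, f G) \<in> face_le P \<longleftrightarrow> (F, G) \<in> face_le P},
      monoid.mult = (\<lambda>f g. compose (faces P) g f),
      one = (\<lambda>F \<in> faces P. F)\<rparr>"

definition chiral :: "('a, 'm) based_poset_scheme \<Rightarrow> bool" where
  "chiral P \<longleftrightarrow>
     card (orbits (aut_group P) (flags P) (\<lambda>f \<Phi>. f ` \<Phi>)) = 2 \<and>
     (\<forall>\<Phi> \<Psi>. adjacent P \<Phi> \<Psi> \<longrightarrow>
        orbit (aut_group P) (\<lambda>f \<Phi>. f ` \<Phi>) \<Phi> \<noteq> orbit (aut_group P) (\<lambda>f \<Phi>. f ` \<Phi>) \<Psi>)"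

(* For chiral polytopes the rotation group is by definition the full automorphism group. *)
abbreviation rot_group :: "('a, 'm) based_poset_scheme \<Rightarrow> ('a \<Rightarrow> 'a) monoid" where
  "rot_group P \<equiv> aut_group P"

definition rot_gen :: "('a, 'm) based_poset_scheme \<Rightarrow> nat \<Rightarrow> 'a \<Rightarrow> 'a" where
  "rot_gen P i = (THE f. f \<in> carrier (rot_group P) \<and>
     f ` base P = adj_flag P (int i - 1) (adj_flag P (int i) (base P)))"

definition mirror_image :: "'a based_poset \<Rightarrow> 'a based_poset" where
  "mirror_image P = P\<lparr>base := adj_flag P 0 (base P)\<rparr>"

definition dual_polytope :: "nat \<Rightarrow> 'a based_poset \<Rightarrow> 'a based_poset" where
  "dual_polytope n P =
     P\<lparr>face_le := converse (face_le P), face_rank := (\<lambda>F. int n - 1 - face_rank P F)\<rparr>"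

(* The letter (x, True) stands for x and (x, False) for its inverse. *)
type_synonym 'x word = "('x \<times> bool) list"

definition words :: "'x set \<Rightarrow> 'x word set" where
  "words X = {w. fst ` set w \<subseteq> X}"

inductive_set pres_rel :: "'x set \<Rightarrow> 'x word set \<Rightarrow> ('x word \<times> 'x word) set"
  for X :: "'x set" and R :: "'x word set" where
  refl: "w \<in> words X \<Longrightarrow> (w, w) \<in> pres_rel X R"
| sym: "(u, v) \<in> pres_rel X R \<Longrightarrow> (v, u) \<in> pres_rel X R"
| trans: "(u, v) \<in> pres_rel X R \<Longrightarrow> (v, w) \<in> pres_rel X R \<Longrightarrow> (u, w) \<in> pres_rel X R"
| append: "(u, u') \<in> pres_rel X R \<Longrightarrow> (v, v') \<in> pres_rel X R \<Longrightarrow> (u @ v, u' @ v') \<in> pres_rel X R"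
| cancel: "x \<in> X \<Longrightarrow> ([(x, b), (x, \<not> b)], []) \<in> pres_rel X R"
| relator: "r \<in> R \<Longrightarrow> r \<in> words X \<Longrightarrow> (r, []) \<in> pres_rel X R"

definition presented_group :: "'x set \<Rightarrow> 'x word set \<Rightarrow> 'x word set monoid" where
  "presented_group X R =
     \<lparr>carrier = words X // pres_rel X R,
      monoid.mult = (\<lambda>A B. \<Union>u \<in> A. \<Union>v \<in> B. pres_rel X R `` {u @ v}),
      one = pres_rel X R `` {[]}\<rparr>"

fun word_val :: "('g, 'm) monoid_scheme \<Rightarrow> ('x \<Rightarrow> 'g) \<Rightarrow> 'x word \<Rightarrow> 'g" where
  "word_val G f [] = \<one>\<^bsub>G\<^esub>"
| "word_val G f ((x, b) # w) = (if b then f x else inv\<^bsub>G\<^esub> f x) \<otimes>\<^bsub>G\<^esub> word_val G f w"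

definition inv_word :: "'x word \<Rightarrow> 'x word" where
  "inv_word w = rev (map (\<lambda>(x, b). (x, \<not> b)) w)"

definition subst_word :: "('x \<Rightarrow> 'y word) \<Rightarrow> 'x word \<Rightarrow> 'y word" where
  "subst_word f w = concat (map (\<lambda>(x, b). if b then f x else inv_word (f x)) w)"

(* A group with k specified generators is given by a group G and x :: nat => 'g, the
   generators being x 1, ..., x k. *)

definition mix :: "nat \<Rightarrow> ('g, 'm) monoid_scheme \<Rightarrow> (nat \<Rightarrow> 'g) \<Rightarrow>
    ('h, 'l) monoid_scheme \<Rightarrow> (nat \<Rightarrow> 'h) \<Rightarrow> ('g \<times> 'h) monoid" where
  "mix k G x H y = subgroup_generated (G \<times>\<times> H) ((\<lambda>i. (x i, y i)) ` {1..k})"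

definition comix_pres :: "nat \<Rightarrow> nat word set \<Rightarrow> nat word set \<Rightarrow> (nat + nat) word set monoid" where
  "comix_pres k R S =
     presented_group ({1..k} <+> {1..k})
       (map (map_prod Inl id) ` R \<union> map (map_prod Inr id) ` S \<union>
        {[(Inl i, False), (Inr i, True)] | i. i \<in> {1..k}})"

definition relators :: "nat \<Rightarrow> ('g, 'm) monoid_scheme \<Rightarrow> (nat \<Rightarrow> 'g) \<Rightarrow> nat word set" where
  "relators k G x = {w \<in> words {1..k}. word_val G x w = \<one>\<^bsub>G\<^esub>}"

(* The comix does not depend on the presentations chosen for the two groups, so the
   presentation by all relators is used. *)
definition comix :: "nat \<Rightarrow> ('g, 'm) monoid_scheme \<Rightarrow> (nat \<Rightarrow> 'g) \<Rightarrow>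
    ('h, 'l) monoid_scheme \<Rightarrow> (nat \<Rightarrow> 'h) \<Rightarrow> (nat + nat) word set monoid" where
  "comix k G x H y = comix_pres k (relators k G x) (relators k H y)"

definition Wplus_relators :: "nat \<Rightarrow> nat word set" where
  "Wplus_relators n =
     {w @ w | w i j. 1 \<le> i \<and> i < j \<and> j \<le> n - 1 \<and> w = map (\<lambda>m. (m, True)) [i..<Suc j]}"

definition Wplus :: "nat \<Rightarrow> nat word set monoid" where
  "Wplus n = presented_group {1..n - 1} (Wplus_relators n)"

definition Wplus_class :: "nat \<Rightarrow> nat word \<Rightarrow> nat word set" where
  "Wplus_class n w = pres_rel {1..n - 1} (Wplus_relators n) `` {w}"

definition bar_gen :: "nat \<Rightarrow> nat word" where
  "bar_gen i = (if i = 1 then [(1, False)]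
                else if i = 2 then [(1, True), (1, True), (2, True)]
                else [(i, True)])"

definition bar :: "nat \<Rightarrow> nat word set \<Rightarrow> nat word set" where
  "bar n A = (\<Union>w \<in> A. Wplus_class n (subst_word bar_gen w))"

(* G = W^+/N *)
definition is_Wplus_quotient ::
    "nat \<Rightarrow> ('g, 'm) monoid_scheme \<Rightarrow> (nat \<Rightarrow> 'g) \<Rightarrow> nat word set set \<Rightarrow> bool" where
  "is_Wplus_quotient n G x N \<longleftrightarrow>
     (\<exists>h \<in> epi (Wplus n) G.
        (\<forall>i \<in> {1..n - 1}. h (Wplus_class n [(i, True)]) = x i) \<and> N = kernel (Wplus n) G h)"

(* The mix of two polytopes is represented by its rotation group with specified
   generators, in terms of which its chirality is defined. *)
definition mix_chiral :: "nat \<Rightarrow> 'a based_poset \<Rightarrow> 'b based_poset \<Rightarrow> bool" where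
  "mix_chiral n P Q \<longleftrightarrow>
     (\<exists>N. is_Wplus_quotient n
            (mix (n - 1) (rot_group P) (rot_gen P) (rot_group Q) (rot_gen Q))
            (\<lambda>i. (rot_gen P i, rot_gen Q i)) N \<and>
          bar n ` N \<noteq> N)"

end

theory Submission
  imports Defs
begin

text \<open>For groups with specified generators the mix of \<open>G\<close> and \<open>H\<close> is the quotient of the free group by
  the intersection of the two relator subgroups, and the comix its quotient by their product. Hence,
  for a fixed \<open>G\<close> and \<open>H\<close> of given order, a larger mix means a smaller comix. If the mix of \<open>P\<close> with
  its dual were invariant under the bar automorphism, every common relator of \<open>P\<close> and its dual would
  also be a relator of the mirror image. The mix of \<open>P\<close> with its dual would then cover the mix
  of \<open>P\<close> with its mirror image, which contradicts the hypothesis on the comixes.\<close>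

section \<open>Words and presented groups\<close>

text \<open>Everything takes place in one group: reversing the order or moving the base flag leaves
  the automorphism group unchanged, so \<open>P\<close>, its dual and its mirror image differ only
  in their specified generators, and the last two systems are words in the first. The counting rests
  on \<open>|mix| * |comix| = |<x>| * |<y>|\<close>: if \<open>A\<close> is the set of values under
  \<open>x\<close> of the relators of \<open>y\<close>, the comix is \<open><x>/A\<close> and the
  mix is an extension of \<open><y>\<close> by \<open>A\<close>. The orders are those of the
  subgroups generated by the specified generators, and these subgroups are linked by inclusions. The
  bar automorphism enters because the generators of the mirror image are the words
  \<open>bar_gen i\<close> in the rotations, so the bar image of \<open>w\<close> evaluated in
  \<open>P\<close> is \<open>w\<close> evaluated in the mirror image. Chirality of the mix also
  asserts that some \<open>N\<close> presents the mix as a quotient of \<open>Wplus\<close>, so the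
  defining relations of \<open>Wplus\<close> have to be verified for \<open>P\<close> and for its
  dual. This is done on flags: an automorphism is determined by the image of one flag, and a
  rotation acts as two flag adjacencies.\<close>

lemma words_Nil [simp]: "[] \<in> words X"
  by (simp add: words_def)

lemma words_Cons [simp]: "p # w \<in> words X \<longleftrightarrow> fst p \<in> X \<and> w \<in> words X"
  by (auto simp: words_def)

lemma words_append [simp]: "u @ v \<in> words X \<longleftrightarrow> u \<in> words X \<and> v \<in> words X"
  by (auto simp: words_def)

lemma inv_word_Nil [simp]: "inv_word [] = []"
  by (simp add: inv_word_def)

lemma inv_word_Cons [simp]: "inv_word ((x, b) # w) = inv_word w @ [(x, \<not> b)]"
  by (simp add: inv_word_def)

lemma inv_word_in_words [simp]: "inv_word w \<in> words X \<longleftrightarrow> w \<in> words X"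
  by (induction w) auto

lemma subst_word_Nil [simp]: "subst_word s [] = []"
  by (simp add: subst_word_def)

lemma subst_word_Cons [simp]:
  "subst_word s ((x, b) # w) = (if b then s x else inv_word (s x)) @ subst_word s w"
  by (simp add: subst_word_def)

lemma subst_word_in_words:
  assumes "s \<in> X \<rightarrow> words Y" "w \<in> words X"
  shows "subst_word s w \<in> words Y"
  using assms(2) by (induction w) (use assms(1) in auto)

section \<open>Evaluation of words in a group\<close>

context group
begin

lemma word_val_closed [intro]:
  assumes "f \<in> X \<rightarrow> carrier G" "w \<in> words X"
  shows "word_val G f w \<in> carrier G"
  using assms(2) by (induction w) (use assms(1) in \<open>auto simp: Pi_iff\<close>)

lemma word_val_append:
  assumes "f \<in> X \<rightarrow> carrier G" "u \<in> words X" "v \<in> words X"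
  shows "word_val G f (u @ v) = word_val G f u \<otimes> word_val G f v"
  using assms(2)
proof (induction u)
  case Nil
  then show ?case using word_val_closed[OF assms(1,3)] by simp
next
  case (Cons p u)
  obtain x b where p: "p = (x, b)" by (cases p)
  have "f x \<in> carrier G" using Cons.prems assms(1) p by auto
  moreover have "word_val G f u \<in> carrier G" "word_val G f v \<in> carrier G"
    using Cons.prems assms by auto
  ultimately show ?case
    using Cons p by (simp add: m_assoc)
qed

lemma word_val_inv_word:
  assumes "f \<in> X \<rightarrow> carrier G" "w \<in> words X"
  shows "word_val G f (inv_word w) = inv (word_val G f w)"
  using assms(2)
proof (induction w)
  case (Cons p w)
  obtain x b where p: "p = (x, b)" by (cases p)
  have x: "x \<in> X" "f x \<in> carrier G" using Cons.prems assms(1) p by auto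
  moreover have "word_val G f w \<in> carrier G"
    using Cons.prems assms by auto
  moreover have "word_val G f (inv_word w @ [(x, \<not> b)])
      = word_val G f (inv_word w) \<otimes> word_val G f [(x, \<not> b)]"
    using Cons.prems x by (intro word_val_append[OF assms(1)]) auto
  ultimately show ?case
    using Cons p by (simp add: inv_mult_group)
qed simp

lemma word_val_subst_word:
  assumes f: "f \<in> Y \<rightarrow> carrier G" and s: "s \<in> X \<rightarrow> words Y" and "w \<in> words X"
  shows "word_val G f (subst_word s w) = word_val G (\<lambda>x. word_val G f (s x)) w"
  using assms(3)
proof (induction w)
  case (Cons p w)
  obtain x b where p: "p = (x, b)" by (cases p)
  have sx: "s x \<in> words Y" and w: "subst_word s w \<in> words Y"
    using Cons.prems s p subst_word_in_words[OF s] by auto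
  show ?case
    using Cons p sx w word_val_append[OF f _ w] word_val_inv_word[OF f sx] by simp
qed simp

lemma word_val_hom:
  assumes "group H" "h \<in> hom G H" "f \<in> X \<rightarrow> carrier G" "w \<in> words X"
  shows "h (word_val G f w) = word_val H (\<lambda>x. h (f x)) w"
proof -
  interpret group_hom G H h
    using assms is_group by (simp add: group_hom_def group_hom_axioms_def)
  show ?thesis
    using assms(4)
  proof (induction w)
    case (Cons p w)
    obtain x b where p: "p = (x, b)" by (cases p)
    have "f x \<in> carrier G" using Cons.prems assms(3) p by auto
    moreover have "word_val G f w \<in> carrier G"
      using Cons.prems assms by auto
    ultimately show ?case using Cons p by simp
  qed simp
qed

lemma word_val_image_words:
  assumes f: "f \<in> X \<rightarrow> carrier G"
  shows "word_val G f ` words X = generate G (f ` X)"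
proof
  show "word_val G f ` words X \<subseteq> generate G (f ` X)"
  proof clarify
    fix w assume "w \<in> words X"
    then show "word_val G f w \<in> generate G (f ` X)"
    proof (induction w)
      case (Cons p w)
      then have "f (fst p) \<in> f ` X" by simp
      then have "(if snd p then f (fst p) else inv f (fst p)) \<in> generate G (f ` X)"
        using generate.incl generate.inv by metis
      then have "(if snd p then f (fst p) else inv f (fst p)) \<otimes> word_val G f w \<in> generate G (f ` X)"
        using Cons by (intro generate.eng) auto
      then show ?case by (cases p) auto
    qed (simp add: generate.one)
  qed
  show "generate G (f ` X) \<subseteq> word_val G f ` words X"
  proof
    fix g assume "g \<in> generate G (f ` X)"
    then show "g \<in> word_val G f ` words X"
    proof induction
      case one
      show ?case by (rule image_eqI[of _ _ "[]"]) simp_all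
    next
      case (incl h)
      then obtain x where "x \<in> X" "h = f x" by blast
      then show ?case
        using funcset_mem[OF f] by (intro image_eqI[of _ _ "[(x, True)]"]) auto
    next
      case (inv h)
      then obtain x where "x \<in> X" "h = f x" by blast
      then show ?case
        using funcset_mem[OF f] by (intro image_eqI[of _ _ "[(x, False)]"]) auto
    next
      case (eng g h)
      then obtain u v where "u \<in> words X" "v \<in> words X"
        "g = word_val G f u" "h = word_val G f v" by blast
      then show ?case
        using word_val_append[OF f] by (intro image_eqI[of _ _ "u @ v"]) auto
    qed
  qed
qed

text \<open>Inverses in a generated subgroup agree with those of \<open>G\<close>; this allows words
  to be evaluated in the mix as in the direct product.\<close>

lemma word_val_subgroup_generated:
  assumes f: "f \<in> X \<rightarrow> carrier G" and "f ` X \<subseteq> S" "w \<in> words X"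
  shows "word_val (subgroup_generated G S) f w = word_val G f w"
  using assms(3)
proof (induction w)
  case (Cons p w)
  obtain x b where p: "p = (x, b)" by (cases p)
  have "f x \<in> carrier (subgroup_generated G S)"
    using Cons.prems assms p by (auto simp: carrier_subgroup_generated intro!: generate.incl)
  then show ?case using Cons p by simp
qed simp

text \<open>Soundness half of von Dyck's theorem, by induction on the derivation. Membership in
  \<open>words X\<close> is carried along because multiplicativity of the value is available for
  such words.\<close>

lemma pres_rel_word_val:
  assumes f: "f \<in> X \<rightarrow> carrier G"
    and R: "\<And>r. r \<in> R \<Longrightarrow> r \<in> words X \<Longrightarrow> word_val G f r = \<one>"
    and "(u, v) \<in> pres_rel X R"
  shows "u \<in> words X \<and> v \<in> words X \<and> word_val G f u = word_val G f v"
  using assms(3)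
proof induction
  case (append u u' v v')
  then show ?case using word_val_append[OF f] by simp
next
  case (cancel x b)
  then have "f x \<in> carrier G" using f by auto
  then show ?case using cancel by simp
qed (use R in auto)

end

section \<open>Congruences of presentations and von Dyck's theorem\<close>

lemma pres_rel_words:
  assumes "(u, v) \<in> pres_rel X R"
  shows "u \<in> words X" "v \<in> words X"
  using assms by (induction) auto

lemma equiv_pres_rel: "equiv (words X) (pres_rel X R)"
proof (rule equivI)
  show "pres_rel X R \<subseteq> words X \<times> words X" by (auto dest: pres_rel_words)
  show "refl_on (words X) (pres_rel X R)" by (auto intro: refl_onI pres_rel.refl)
  show "sym (pres_rel X R)" by (auto intro: symI pres_rel.sym)
  show "trans (pres_rel X R)" by (auto intro: transI pres_rel.trans)
qed

lemma pres_rel_inv_word: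
  assumes "w \<in> words X"
  shows "(inv_word w @ w, []) \<in> pres_rel X R"
  using assms
proof (induction w)
  case Nil
  show ?case by (simp add: pres_rel.refl)
next
  case (Cons p w)
  obtain x b where p: "p = (x, b)" by (cases p)
  have x: "x \<in> X" and w: "w \<in> words X" using Cons.prems p by auto
  have "([(x, \<not> b), (x, b)], []) \<in> pres_rel X R"
    using pres_rel.cancel[OF x, of "\<not> b"] by simp
  then have "(inv_word w @ ([(x, \<not> b), (x, b)] @ w), inv_word w @ ([] @ w)) \<in> pres_rel X R"
    using w by (intro pres_rel.append) (auto intro: pres_rel.refl)
  then have "(inv_word w @ ([(x, \<not> b), (x, b)] @ w), []) \<in> pres_rel X R"
    by (rule pres_rel.trans) (simp add: Cons.IH[OF w])
  then show ?case using p by simp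
qed

text \<open>The product is a union over all representatives; \<open>append\<close> makes every
  member of that union the same class, and reflexivity keeps the index sets nonempty.\<close>

lemma presented_group_mult_class:
  assumes "u \<in> words X" "v \<in> words X"
  shows "pres_rel X R `` {u} \<otimes>\<^bsub>presented_group X R\<^esub> pres_rel X R `` {v} = pres_rel X R `` {u @ v}"
proof -
  let ?C = "\<lambda>w. pres_rel X R `` {w}"
  have "?C u \<otimes>\<^bsub>presented_group X R\<^esub> ?C v = (\<Union>u' \<in> ?C u. \<Union>v' \<in> ?C v. ?C (u' @ v'))"
    by (simp add: presented_group_def)
  also have "\<dots> = (\<Union>u' \<in> ?C u. \<Union>v' \<in> ?C v. ?C (u @ v))"
  proof (rule SUP_cong[OF HOL.refl], rule SUP_cong[OF HOL.refl])
    fix u' v' assume "u' \<in> ?C u" "v' \<in> ?C v"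
    then have "(u @ v, u' @ v') \<in> pres_rel X R" by (auto intro: pres_rel.append)
    then show "?C (u' @ v') = ?C (u @ v)"
      using equiv_class_eq[OF equiv_pres_rel] by metis
  qed
  also have "\<dots> = ?C (u @ v)"
    using pres_rel.refl[OF assms(1)] pres_rel.refl[OF assms(2)] by blast
  finally show ?thesis .
qed

text \<open>Von Dyck's theorem. The map evaluates an arbitrary representative, which is harmless by
  \<open>pres_rel_word_val\<close>; the generation hypothesis gives surjectivity.\<close>

lemma (in group) presented_group_epi:
  assumes f: "f \<in> X \<rightarrow> carrier G" and gen: "generate G (f ` X) = carrier G"
    and R: "\<And>r. r \<in> R \<Longrightarrow> r \<in> words X \<Longrightarrow> word_val G f r = \<one>"
  obtains h where "h \<in> epi (presented_group X R) G"
    "\<And>w. w \<in> words X \<Longrightarrow> h (pres_rel X R `` {w}) = word_val G f w"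
proof -
  define h where "h A = word_val G f (SOME w. w \<in> A)" for A
  have h: "h (pres_rel X R `` {w}) = word_val G f w" if "w \<in> words X" for w
  proof -
    have "(SOME v. v \<in> pres_rel X R `` {w}) \<in> pres_rel X R `` {w}"
      by (rule someI[of "\<lambda>v. v \<in> pres_rel X R `` {w}" w]) (use that in \<open>auto intro: pres_rel.refl\<close>)
    then show ?thesis
      unfolding h_def using pres_rel_word_val[OF f R] by (metis Image_singleton_iff)
  qed
  have car: "carrier (presented_group X R) = (\<lambda>w. pres_rel X R `` {w}) ` words X"
    by (auto simp: presented_group_def quotient_def)
  have "h \<in> hom (presented_group X R) G"
  proof (rule homI)
    fix A B assume "A \<in> carrier (presented_group X R)" "B \<in> carrier (presented_group X R)"
    then obtain u v where uv: "u \<in> words X" "v \<in> words X"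
      "A = pres_rel X R `` {u}" "B = pres_rel X R `` {v}" unfolding car by blast
    then show "h (A \<otimes>\<^bsub>presented_group X R\<^esub> B) = h A \<otimes> h B"
      using word_val_append[OF f] by (simp add: presented_group_mult_class h)
  qed (use word_val_closed[OF f] h car in auto)
  moreover have "h ` carrier (presented_group X R) = carrier G"
    unfolding car image_image gen[symmetric] word_val_image_words[OF f, symmetric]
    by (rule image_cong) (simp_all add: h)
  ultimately have "h \<in> epi (presented_group X R) G" by (simp add: epi_def)
  then show thesis using h by (rule that)
qed

text \<open>First isomorphism theorem for sets: a class goes to the value of any representative.
  Being a bijection, this also settles infinite sets, where \<open>card\<close> is 0.\<close>

lemma card_quotient_kernel:
  assumes "equiv A r" and "\<And>u v. u \<in> A \<Longrightarrow> v \<in> A \<Longrightarrow> (u, v) \<in> r \<longleftrightarrow> g u = g v"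
  shows "card (A // r) = card (g ` A)"
proof -
  have "bij_betw (\<lambda>C. g (SOME u. u \<in> C)) (A // r) (g ` A)"
  proof -
    have g: "g (SOME u. u \<in> r `` {a}) = g a" if "a \<in> A" for a
    proof -
      have "(SOME u. u \<in> r `` {a}) \<in> r `` {a}"
        by (rule someI[of "\<lambda>u. u \<in> r `` {a}" a]) (rule equiv_class_self[OF assms(1) that])
      then show ?thesis
        using assms(2)[OF that] equiv_type[OF assms(1)] by auto
    qed
    show ?thesis
    proof (intro bij_betwI' )
      fix C D assume "C \<in> A // r" "D \<in> A // r"
      then obtain a b where "a \<in> A" "b \<in> A" "C = r `` {a}" "D = r `` {b}"
        by (auto simp: quotient_def)
      then show "(g (SOME u. u \<in> C) = g (SOME u. u \<in> D)) = (C = D)"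
        using g assms eq_equiv_class_iff[OF assms(1)] by simp
    next
      fix C assume "C \<in> A // r"
      then show "g (SOME u. u \<in> C) \<in> g ` A" using g by (auto simp: quotient_def)
    next
      fix y assume "y \<in> g ` A"
      then show "\<exists>C \<in> A // r. y = g (SOME u. u \<in> C)"
        using g by (auto simp: quotient_def)
    qed
  qed
  then show ?thesis by (rule bij_betw_same_card)
qed

section \<open>The order of the comix\<close>

lemma inv_word_append: "inv_word (u @ v) = inv_word v @ inv_word u"
  by (simp add: inv_word_def)

lemma inv_word_inv_word [simp]: "inv_word (inv_word w) = w"
  by (induction w) (auto simp: inv_word_append)

lemma inv_word_map: "inv_word (map (map_prod g id) w) = map (map_prod g id) (inv_word w)"
  by (induction w) auto

lemma map_in_words:
  assumes "g \<in> X \<rightarrow> Y" "w \<in> words X"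
  shows "map (map_prod g id) w \<in> words Y"
  using assms(2) by (induction w) (use assms(1) in auto)

lemma word_val_map: "word_val G f (map (map_prod g id) w) = word_val G (\<lambda>x. f (g x)) w"
  by (induction w) auto

lemma pres_rel_of_inv_word_append:
  assumes "(inv_word a @ b, []) \<in> pres_rel X R" and a: "a \<in> words X"
  shows "(b, a) \<in> pres_rel X R"
proof -
  have b: "b \<in> words X" using pres_rel_words[OF assms(1)] by simp
  have "(a @ inv_word a, []) \<in> pres_rel X R"
    using pres_rel_inv_word[of "inv_word a" X R] a by simp
  then have "((a @ inv_word a) @ b, [] @ b) \<in> pres_rel X R"
    by (rule pres_rel.append[OF _ pres_rel.refl[OF b]])
  then have "(b, (a @ inv_word a) @ b) \<in> pres_rel X R"
    by (simp add: pres_rel.sym)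
  moreover have "(a @ (inv_word a @ b), a @ []) \<in> pres_rel X R"
    by (rule pres_rel.append[OF pres_rel.refl[OF a] assms(1)])
  ultimately show ?thesis using pres_rel.trans by fastforce
qed

text \<open>Inversion is not among the closure rules of \<open>pres_rel\<close>. It is derived from
  \<open>append\<close>: replacing \<open>b\<close> by \<open>a\<close> turns
  \<open>b @ inv_word a\<close> into a word that cancels.\<close>

lemma pres_rel_inv_word_cong:
  assumes ab: "(a, b) \<in> pres_rel X R"
  shows "(inv_word a, inv_word b) \<in> pres_rel X R"
proof (rule pres_rel_of_inv_word_append)
  have a: "a \<in> words X" and b: "b \<in> words X" using pres_rel_words[OF ab] .
  have "(inv_word (inv_word b) @ inv_word a, a @ inv_word a) \<in> pres_rel X R"
    using pres_rel.append[OF pres_rel.sym[OF ab] pres_rel.refl[of "inv_word a"]] a by simp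
  moreover have "(a @ inv_word a, []) \<in> pres_rel X R"
    using pres_rel_inv_word[of "inv_word a" X R] a by simp
  ultimately show "(inv_word (inv_word b) @ inv_word a, []) \<in> pres_rel X R"
    by (rule pres_rel.trans)
  show "inv_word b \<in> words X" using b by simp
qed

abbreviation fold_letters :: "('x + 'x) word \<Rightarrow> 'x word" where
  "fold_letters \<equiv> map (map_prod (case_sum id id) id)"

abbreviation inl_word :: "'x word \<Rightarrow> ('x + 'y) word" where
  "inl_word \<equiv> map (map_prod Inl id)"

abbreviation inr_word :: "'y word \<Rightarrow> ('x + 'y) word" where
  "inr_word \<equiv> map (map_prod Inr id)"

text \<open>The relators identifying the two copies of a generator allow each right letter to be
  exchanged for its left twin, inverse letters by \<open>pres_rel_inv_word_cong\<close>. Every class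
  of the comix thus has a representative in left letters alone.\<close>

lemma pres_rel_fold_letters:
  assumes R: "\<And>i. i \<in> X \<Longrightarrow> [(Inl i, False), (Inr i, True)] \<in> R" and "w \<in> words (X <+> X)"
  shows "(w, inl_word (fold_letters w)) \<in> pres_rel (X <+> X) R"
  using assms(2)
proof (induction w)
  case Nil
  show ?case by (simp add: pres_rel.refl)
next
  case (Cons p w)
  have r: "([(Inr i, True)], [(Inl i, True)]) \<in> pres_rel (X <+> X) R" if "i \<in> X" for i
    by (rule pres_rel_of_inv_word_append)
      (use that pres_rel.relator[OF R[OF that], of "X <+> X"] in auto)
  obtain s b where p: "p = (s, b)" by (cases p)
  have "([p], inl_word (fold_letters [p])) \<in> pres_rel (X <+> X) R"
  proof (cases s)
    case (Inl i)
    then show ?thesis using Cons.prems p by (auto intro!: pres_rel.refl)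
  next
    case (Inr i)
    then have "i \<in> X" using Cons.prems p by auto
    from r[OF this] pres_rel_inv_word_cong[OF r[OF this]] show ?thesis
      using p Inr by (cases b) auto
  qed
  moreover have "(w, inl_word (fold_letters w)) \<in> pres_rel (X <+> X) R"
    using Cons.IH Cons.prems by (simp only: words_Cons)
  ultimately have "([p] @ w, inl_word (fold_letters [p]) @ inl_word (fold_letters w)) \<in> pres_rel (X <+> X) R"
    by (rule pres_rel.append)
  then show ?case by (simp only: list.map append_Cons append_Nil)
qed

text \<open>Seen from the free group on \<open>{1..k}\<close>, this is the image under
  \<open>x\<close> of the kernel of \<open>y\<close>.\<close>

lemma word_val_relators_subgroup:
  fixes k :: nat
  assumes "group G" "group H" and x: "x \<in> {1..k} \<rightarrow> carrier G" and y: "y \<in> {1..k} \<rightarrow> carrier H"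
  shows "subgroup (word_val G x ` relators k H y) G"
proof -
  interpret G: group G by fact
  interpret H: group H by fact
  show ?thesis
  proof (rule G.subgroupI)
    show "word_val G x ` relators k H y \<subseteq> carrier G"
      using G.word_val_closed[OF x] by (auto simp: relators_def)
    have "[] \<in> relators k H y" by (simp add: relators_def)
    then show "word_val G x ` relators k H y \<noteq> {}" by blast
  next
    fix a assume "a \<in> word_val G x ` relators k H y"
    then obtain w where "w \<in> relators k H y" "a = word_val G x w" by blast
    then show "inv\<^bsub>G\<^esub> a \<in> word_val G x ` relators k H y"
      using G.word_val_inv_word[OF x] H.word_val_inv_word[OF y]
      by (intro image_eqI[of _ _ "inv_word w"]) (auto simp: relators_def)
  next
    fix a b assume "a \<in> word_val G x ` relators k H y" "b \<in> word_val G x ` relators k H y"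
    then obtain v w where "v \<in> relators k H y" "a = word_val G x v"
      "w \<in> relators k H y" "b = word_val G x w" by blast
    then show "a \<otimes>\<^bsub>G\<^esub> b \<in> word_val G x ` relators k H y"
      using G.word_val_append[OF x] H.word_val_append[OF y]
      by (intro image_eqI[of _ _ "v @ w"]) (auto simp: relators_def)
  qed
qed

text \<open>The comix is the free group modulo both kernels. Dividing by the kernel of
  \<open>x\<close> first leaves \<open>G\<close> modulo the image \<open>A\<close> of the kernel of
  \<open>y\<close>, and Lagrange's theorem gives the product.\<close>

lemma order_comix_of_generating:
  fixes k :: nat
  assumes "group G" "group H" and x: "x \<in> {1..k} \<rightarrow> carrier G" and y: "y \<in> {1..k} \<rightarrow> carrier H"
    and gen: "generate G (x ` {1..k}) = carrier G"
  shows "order (comix k G x H y) * card (word_val G x ` relators k H y) = order G"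
proof -
  interpret G: group G by fact
  interpret H: group H by fact
  define X where "X = {1..k}"
  define A where "A = word_val G x ` relators k H y"
  define R where "R = inl_word ` relators k G x \<union> inr_word ` relators k H y
    \<union> {[(Inl i, False), (Inr i, True)] | i. i \<in> X}"
  define x' where "x' s = x (case_sum id id s)" for s
  note x = x[folded X_def] and y = y[folded X_def] and gen = gen[folded X_def]
  have rels_H: "w \<in> relators k H y \<longleftrightarrow> w \<in> words X \<and> word_val H y w = \<one>\<^bsub>H\<^esub>"
    and rels_G: "w \<in> relators k G x \<longleftrightarrow> w \<in> words X \<and> word_val G x w = \<one>\<^bsub>G\<^esub>" for w
    by (simp_all add: relators_def X_def)
  have x': "x' \<in> X <+> X \<rightarrow> carrier G" using x by (auto simp: x'_def)
  have sub: "subgroup A G"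
    unfolding A_def using assms by (intro word_val_relators_subgroup)
  \<comment> \<open>Relators of \<open>H\<close> are closed under conjugation by words, and every
    element of \<open>G\<close> is the value of a word because \<open>x\<close> generates.\<close>
  have "A \<lhd> G"
    unfolding G.normal_inv_iff
  proof (intro conjI sub ballI)
    fix g a assume "g \<in> carrier G" "a \<in> A"
    from \<open>g \<in> carrier G\<close> obtain u where u: "u \<in> words X" "g = word_val G x u"
      using G.word_val_image_words[OF x] gen by auto
    from \<open>a \<in> A\<close> obtain w where "w \<in> relators k H y" "a = word_val G x w"
      by (auto simp: A_def)
    note uw = u this
    have w: "w \<in> words X" using uw(3) by (simp add: rels_H)
    have "u @ w @ inv_word u \<in> relators k H y"
      using uw w H.word_val_append[OF y] H.word_val_inv_word[OF y] H.word_val_closed[OF y]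
      by (simp add: rels_H)
    moreover have "g \<otimes>\<^bsub>G\<^esub> a \<otimes>\<^bsub>G\<^esub> inv\<^bsub>G\<^esub> g = word_val G x (u @ w @ inv_word u)"
      using uw w G.word_val_append[OF x] G.word_val_inv_word[OF x] G.word_val_closed[OF x]
      by (simp add: G.m_assoc)
    ultimately show "g \<otimes>\<^bsub>G\<^esub> a \<otimes>\<^bsub>G\<^esub> inv\<^bsub>G\<^esub> g \<in> A" by (simp add: A_def)
  qed
  then interpret A: normal A G .
  \<comment> \<open>The congruence of the comix is the kernel of evaluation followed by passage to
    cosets of \<open>A\<close>. Forwards, every relator dies in \<open>G Mod A\<close>; backwards,
    the equation of cosets is turned into a derivation.\<close>
  have rel_iff: "(u, v) \<in> pres_rel (X <+> X) R \<longleftrightarrow> A #>\<^bsub>G\<^esub> word_val G x' u = A #>\<^bsub>G\<^esub> word_val G x' v"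
    if u: "u \<in> words (X <+> X)" and v: "v \<in> words (X <+> X)" for u v
  proof
    interpret Q: group "G Mod A" by (rule A.factorgroup_is_group)
    define q where "q = (\<lambda>s. A #>\<^bsub>G\<^esub> x' s)"
    have q: "q \<in> X <+> X \<rightarrow> carrier (G Mod A)"
      using x' by (auto simp: q_def carrier_FactGroup)
    have val_q: "word_val (G Mod A) q w = A #>\<^bsub>G\<^esub> word_val G x' w" if "w \<in> words (X <+> X)" for w
      using G.word_val_hom[OF A.factorgroup_is_group A.r_coset_hom_Mod x' that] by (simp add: q_def)
    assume uv: "(u, v) \<in> pres_rel (X <+> X) R"
    have "word_val G x' r \<in> A" if r: "r \<in> R" for r
    proof -
      consider w where "w \<in> relators k G x" "r = inl_word w"
        | w where "w \<in> relators k H y" "r = inr_word w"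
        | i where "i \<in> X" "r = [(Inl i, False), (Inr i, True)]"
        using r unfolding R_def by blast
      then show ?thesis
      proof cases
        case 1
        then show ?thesis
          using A.one_closed by (simp add: word_val_map x'_def rels_G)
      next
        case 2
        then show ?thesis by (simp add: word_val_map x'_def A_def)
      next
        case 3
        then show ?thesis using x A.one_closed by (auto simp: x'_def Pi_iff)
      qed
    qed
    then have "word_val (G Mod A) q r = \<one>\<^bsub>G Mod A\<^esub>" if "r \<in> R" "r \<in> words (X <+> X)" for r
      using that val_q G.coset_join2[OF _ sub] G.word_val_closed[OF x'] by simp
    from Q.pres_rel_word_val[OF q this uv]
    show "A #>\<^bsub>G\<^esub> word_val G x' u = A #>\<^bsub>G\<^esub> word_val G x' v"
      using val_q u v by simp
  next
    assume eq: "A #>\<^bsub>G\<^esub> word_val G x' u = A #>\<^bsub>G\<^esub> word_val G x' v"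
    define u0 where "u0 = fold_letters u"
    define v0 where "v0 = fold_letters v"
    have uv0: "u0 \<in> words X" "v0 \<in> words X"
      unfolding u0_def v0_def using u v
      by (auto intro!: map_in_words[of "case_sum id id" "X <+> X" X])
    have val_uv: "word_val G x' u = word_val G x u0" "word_val G x' v = word_val G x v0"
      unfolding u0_def v0_def x'_def by (simp_all add: word_val_map)
    \<comment> \<open>Equal cosets differ by the value of a relator \<open>s\<close> of
      \<open>H\<close>. A relator of \<open>G\<close> then identifies \<open>u0\<close> with
      \<open>s @ v0\<close>, and \<open>s\<close> is removed by rewriting its left copy into the
      right one, where it is a relator.\<close>
    have "word_val G x u0 \<in> A #>\<^bsub>G\<^esub> word_val G x v0"
      using eq G.rcos_self[OF _ sub] G.word_val_closed[OF x uv0(1)] unfolding val_uv by metis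
    then obtain s where s: "s \<in> relators k H y"
      and val_s: "word_val G x u0 = word_val G x s \<otimes>\<^bsub>G\<^esub> word_val G x v0"
      unfolding r_coset_def A_def by blast
    have sw: "s \<in> words X" using s by (simp add: rels_H)
    have "inv_word (s @ v0) @ u0 \<in> relators k G x"
      using sw uv0 val_s G.word_val_append[OF x] G.word_val_inv_word[OF x] G.word_val_closed[OF x]
      by (simp add: rels_G)
    then have "inl_word (inv_word (s @ v0) @ u0) \<in> R" unfolding R_def by blast
    moreover have inl: "inl_word w \<in> words (X <+> X)" and inr: "inr_word w \<in> words (X <+> X)"
      if "w \<in> words X" for w
      using that map_in_words[of Inl X "X <+> X"] map_in_words[of Inr X "X <+> X"] by auto
    ultimately have "(inl_word (inv_word (s @ v0) @ u0), []) \<in> pres_rel (X <+> X) R"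
      using sw uv0 by (intro pres_rel.relator inl) simp_all
    then have "(inv_word (inl_word (s @ v0)) @ inl_word u0, []) \<in> pres_rel (X <+> X) R"
      unfolding inv_word_map by simp
    then have 1: "(inl_word u0, inl_word (s @ v0)) \<in> pres_rel (X <+> X) R"
      by (rule pres_rel_of_inv_word_append) (use sw uv0 inl[of "s @ v0"] in simp)
    have fold: "(w, inl_word (fold_letters w)) \<in> pres_rel (X <+> X) R" if "w \<in> words (X <+> X)" for w
      using that by (intro pres_rel_fold_letters) (auto simp: R_def)
    have "fold_letters (inr_word s) = s"
      by (induction s) auto
    then have "(inl_word s, inr_word s) \<in> pres_rel (X <+> X) R"
      using pres_rel.sym[OF fold[OF inr[OF sw]]] by simp
    moreover have "(inr_word s, []) \<in> pres_rel (X <+> X) R"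
      using s inr[OF sw] by (intro pres_rel.relator) (auto simp: R_def)
    ultimately have "(inl_word s, []) \<in> pres_rel (X <+> X) R"
      by (rule pres_rel.trans)
    from pres_rel.append[OF this pres_rel.refl[OF inl[OF uv0(2)]]]
    have 2: "(inl_word (s @ v0), inl_word v0) \<in> pres_rel (X <+> X) R" by simp
    show "(u, v) \<in> pres_rel (X <+> X) R"
      using pres_rel.trans[OF fold[OF u, folded u0_def] pres_rel.trans[OF 1
        pres_rel.trans[OF 2 pres_rel.sym[OF fold[OF v, folded v0_def]]]]] .
  qed
  have "order (comix k G x H y) = card (words (X <+> X) // pres_rel (X <+> X) R)"
    by (simp add: order_def comix_def comix_pres_def presented_group_def R_def X_def)
  also have "\<dots> = card ((\<lambda>w. A #>\<^bsub>G\<^esub> word_val G x' w) ` words (X <+> X))"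
    by (rule card_quotient_kernel[OF equiv_pres_rel rel_iff])
  also have "(\<lambda>w. A #>\<^bsub>G\<^esub> word_val G x' w) ` words (X <+> X)
      = (\<lambda>g. A #>\<^bsub>G\<^esub> g) ` (word_val G x' ` words (X <+> X))"
    by (simp add: image_image)
  also have "word_val G x' ` words (X <+> X) = carrier G"
  proof -
    have "x' ` (X <+> X) = x ` X" by (force simp: x'_def image_iff)
    then show ?thesis using G.word_val_image_words[OF x'] gen by simp
  qed
  also have "(\<lambda>g. A #>\<^bsub>G\<^esub> g) ` carrier G = rcosets\<^bsub>G\<^esub> A"
    by (auto simp: RCOSETS_def)
  finally show ?thesis using G.lagrange[OF sub] by (simp add: A_def)
qed

text \<open>Values of words stay inside the subgroup generated by \<open>x\<close>, so the relators,
  the set \<open>A\<close> and the comix are unchanged when \<open>G\<close> is replaced by that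
  subgroup, and there \<open>x\<close> generates.\<close>

lemma order_comix:
  fixes k :: nat
  assumes "group G" "group H" and x: "x \<in> {1..k} \<rightarrow> carrier G" and y: "y \<in> {1..k} \<rightarrow> carrier H"
  shows "order (comix k G x H y) * card (word_val G x ` relators k H y) = card (generate G (x ` {1..k}))"
proof -
  interpret G: group G by fact
  define K where "K = subgroup_generated G (x ` {1..k})"
  have car: "carrier K = generate G (x ` {1..k})"
    using x by (simp add: K_def carrier_subgroup_generated Int_absorb1 image_subset_iff_funcset)
  interpret K: group K by (simp add: K_def)
  have xK: "x \<in> {1..k} \<rightarrow> carrier K"
    by (auto simp: car intro: generate.incl)
  have val: "word_val K x w = word_val G x w" if "w \<in> words {1..k}" for w
    unfolding K_def using that by (intro G.word_val_subgroup_generated[OF x]) auto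
  have "generate K (x ` {1..k}) = carrier K"
    unfolding K.word_val_image_words[OF xK, symmetric] car G.word_val_image_words[OF x, symmetric]
    using val by (rule image_cong[OF HOL.refl])
  moreover have "relators k K x = relators k G x"
    using val by (auto simp: relators_def K_def)
  moreover have "word_val K x ` relators k H y = word_val G x ` relators k H y"
    by (rule image_cong[OF HOL.refl]) (simp add: val relators_def)
  ultimately show ?thesis
    using order_comix_of_generating[OF K.is_group assms(2) xK y]
    by (simp add: comix_def order_def car)
qed

text \<open>The pairs form the mix. Its projection to the second component has the subgroup
  generated by \<open>y\<close> as image and the values of the relators of \<open>H\<close> as
  kernel.\<close>

lemma card_word_val_pairs:
  fixes k :: nat
  assumes "group G" "group H" and x: "x \<in> {1..k} \<rightarrow> carrier G" and y: "y \<in> {1..k} \<rightarrow> carrier H"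
  shows "card ((\<lambda>w. (word_val G x w, word_val H y w)) ` words {1..k})
    = card (word_val G x ` relators k H y) * card (generate H (y ` {1..k}))"
proof -
  interpret G: group G by fact
  interpret H: group H by fact
  define A where "A = word_val G x ` relators k H y"
  define V where "V = word_val H y ` words {1..k}"
  \<comment> \<open>A set-theoretic section: a word with prescribed value in \<open>H\<close>.
    Dividing by it leaves the value of a relator of \<open>H\<close>, so every pair is coded by an
    element of \<open>A\<close> and its second component.\<close>
  define c where "c h = (SOME w. w \<in> words {1..k} \<and> word_val H y w = h)" for h
  have c: "c h \<in> words {1..k}" "word_val H y (c h) = h" if "h \<in> V" for h
    using someI_ex[of "\<lambda>w. w \<in> words {1..k} \<and> word_val H y w = h"] that
    by (auto simp: V_def c_def)
  have cG: "word_val G x (c h) \<in> carrier G" if "h \<in> V" for h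
    using G.word_val_closed[OF x c(1)[OF that]] .
  have A: "A \<subseteq> carrier G"
    using G.word_val_closed[OF x] by (auto simp: A_def relators_def)
  define p where "p = (\<lambda>(a, h). (a \<otimes>\<^bsub>G\<^esub> word_val G x (c h), h))"
  have "inj_on p (A \<times> V)"
    using A cG by (auto simp: inj_on_def p_def subset_iff)
  moreover have "p ` (A \<times> V) = (\<lambda>w. (word_val G x w, word_val H y w)) ` words {1..k}"
  proof (intro equalityI subsetI)
    fix z assume "z \<in> p ` (A \<times> V)"
    then obtain s h where s: "s \<in> relators k H y" and h: "h \<in> V"
      and z: "z = (word_val G x s \<otimes>\<^bsub>G\<^esub> word_val G x (c h), h)"
      by (auto simp: p_def A_def)
    have sw: "s \<in> words {1..k}" "word_val H y s = \<one>\<^bsub>H\<^esub>" using s by (auto simp: relators_def)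
    have "h \<in> carrier H" using H.word_val_closed[OF y c(1)[OF h]] c(2)[OF h] by simp
    then show "z \<in> (\<lambda>w. (word_val G x w, word_val H y w)) ` words {1..k}"
      using sw c[OF h] G.word_val_append[OF x sw(1)] H.word_val_append[OF y sw(1)] z
      by (intro image_eqI[of _ _ "s @ c h"]) auto
  next
    fix z assume "z \<in> (\<lambda>w. (word_val G x w, word_val H y w)) ` words {1..k}"
    then obtain w where w: "w \<in> words {1..k}" and z: "z = (word_val G x w, word_val H y w)" by blast
    define h where "h = word_val H y w"
    have h: "h \<in> V" using w by (simp add: h_def V_def)
    have "h \<in> carrier H" using H.word_val_closed[OF y w] h_def by simp
    then have "w @ inv_word (c h) \<in> relators k H y"
      using w c[OF h] H.word_val_append[OF y w] H.word_val_inv_word[OF y]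
      by (simp add: relators_def flip: h_def)
    then have "word_val G x w \<otimes>\<^bsub>G\<^esub> inv\<^bsub>G\<^esub> word_val G x (c h) \<in> A"
      unfolding A_def using w c[OF h] G.word_val_append[OF x w] G.word_val_inv_word[OF x]
      by (intro image_eqI[of _ _ "w @ inv_word (c h)"]) auto
    then show "z \<in> p ` (A \<times> V)"
      using h z cG[OF h] G.word_val_closed[OF x w]
      by (intro image_eqI[of _ _ "(word_val G x w \<otimes>\<^bsub>G\<^esub> inv\<^bsub>G\<^esub> word_val G x (c h), h)"])
        (auto simp: p_def h_def G.m_assoc)
  qed
  ultimately show ?thesis
    using card_image[of p "A \<times> V"] H.word_val_image_words[OF y]
    by (simp add: card_cartesian_product A_def V_def)
qed

section \<open>Flags and automorphisms of a polytope\<close>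

lemma carrier_aut_group:
  "f \<in> carrier (aut_group P) \<longleftrightarrow> f \<in> Bij (faces P) \<and>
     (\<forall>F \<in> faces P. \<forall>G \<in> faces P. (f F, f G) \<in> face_le P \<longleftrightarrow> (F, G) \<in> face_le P)"
  by (simp add: aut_group_def)

lemma mult_aut_group: "f \<otimes>\<^bsub>aut_group P\<^esub> g = compose (faces P) g f"
  by (simp add: aut_group_def)

lemma one_aut_group: "\<one>\<^bsub>aut_group P\<^esub> = (\<lambda>F \<in> faces P. F)"
  by (simp add: aut_group_def)

lemma group_aut_group: "group (aut_group P)"
proof (rule groupI)
  fix f g assume f: "f \<in> carrier (aut_group P)" and g: "g \<in> carrier (aut_group P)"
  have "f F \<in> faces P" if "F \<in> faces P" for F
    using f that Bij_imp_funcset by (auto simp: carrier_aut_group)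
  then show "f \<otimes>\<^bsub>aut_group P\<^esub> g \<in> carrier (aut_group P)"
    using f g by (auto simp: mult_aut_group carrier_aut_group compose_Bij compose_eq)
next
  show "\<one>\<^bsub>aut_group P\<^esub> \<in> carrier (aut_group P)"
    by (simp add: one_aut_group carrier_aut_group id_Bij)
next
  fix f g h assume "f \<in> carrier (aut_group P)" "g \<in> carrier (aut_group P)" "h \<in> carrier (aut_group P)"
  then show "f \<otimes>\<^bsub>aut_group P\<^esub> g \<otimes>\<^bsub>aut_group P\<^esub> h = f \<otimes>\<^bsub>aut_group P\<^esub> (g \<otimes>\<^bsub>aut_group P\<^esub> h)"
    using compose_assoc[OF Bij_imp_funcset, of f "faces P" h g]
    by (simp add: mult_aut_group carrier_aut_group)
next
  fix f assume "f \<in> carrier (aut_group P)"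
  then show "\<one>\<^bsub>aut_group P\<^esub> \<otimes>\<^bsub>aut_group P\<^esub> f = f"
    using compose_Id[OF Bij_imp_funcset Bij_imp_extensional, of f "faces P"]
    by (simp add: mult_aut_group carrier_aut_group one_aut_group)
next
  fix f assume f: "f \<in> carrier (aut_group P)"
  define g where "g = (\<lambda>F \<in> faces P. inv_into (faces P) f F)"
  have bij: "f ` faces P = faces P" using f by (auto simp: carrier_aut_group Bij_def bij_betw_def)
  have "g \<in> Bij (faces P)"
    using f restrict_inv_into_Bij[of f "faces P"] by (simp add: carrier_aut_group g_def)
  moreover have g: "g F \<in> faces P" "f (g F) = F" if "F \<in> faces P" for F
    using that bij by (auto simp: g_def inv_into_into f_inv_into_f)
  have "(g F, g G) \<in> face_le P \<longleftrightarrow> (F, G) \<in> face_le P" if "F \<in> faces P" "G \<in> faces P" for F G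
    using f g[OF that(1)] g[OF that(2)] unfolding carrier_aut_group by metis
  ultimately have "g \<in> carrier (aut_group P)" by (simp add: carrier_aut_group)
  moreover have "g \<otimes>\<^bsub>aut_group P\<^esub> f = \<one>\<^bsub>aut_group P\<^esub>"
    using g by (auto simp: mult_aut_group one_aut_group compose_def)
  ultimately show "\<exists>g \<in> carrier (aut_group P). g \<otimes>\<^bsub>aut_group P\<^esub> f = \<one>\<^bsub>aut_group P\<^esub>" by blast
qed

text \<open>Members of \<open>Bij\<close> are extensional, hence lie in a finite product of copies
  of the face set.\<close>

lemma finite_carrier_aut_group:
  assumes "finite (faces P)"
  shows "finite (carrier (aut_group P))"
proof (rule finite_subset)
  show "carrier (aut_group P) \<subseteq> (\<Pi>\<^sub>E F \<in> faces P. faces P)"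
  proof
    fix f assume "f \<in> carrier (aut_group P)"
    then have "f \<in> Bij (faces P)" by (simp add: carrier_aut_group)
    then show "f \<in> (\<Pi>\<^sub>E F \<in> faces P. faces P)"
      unfolding PiE_def using Bij_imp_funcset Bij_imp_extensional by (intro IntI)
  qed
  show "finite (\<Pi>\<^sub>E F \<in> faces P. faces P)" using assms by (simp add: finite_PiE)
qed

lemma image_mult_aut_group:
  assumes "\<Phi> \<subseteq> faces P"
  shows "(f \<otimes>\<^bsub>aut_group P\<^esub> g) ` \<Phi> = g ` f ` \<Phi>"
  using assms by (force simp: mult_aut_group compose_eq image_iff subset_iff)

lemma image_one_aut_group:
  assumes "\<Phi> \<subseteq> faces P"
  shows "\<one>\<^bsub>aut_group P\<^esub> ` \<Phi> = \<Phi>"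
  using assms by (force simp: one_aut_group image_iff subset_iff)

lemma flags_subset_Chains: "\<Phi> \<in> flags P \<Longrightarrow> \<Phi> \<in> Chains (face_le P)"
  by (simp add: flags_def)

text \<open>Reads a flag as a function of the rank, so that adjacency becomes disagreement at a
  single argument. The value is meaningful for ranks from -1 to n.\<close>

definition face_at :: "('a, 'm) based_poset_scheme \<Rightarrow> 'a set \<Rightarrow> int \<Rightarrow> 'a" where
  "face_at P \<Phi> j = (THE F. F \<in> \<Phi> \<and> face_rank P F = j)"

locale finite_polytope =
  fixes n :: nat and P :: "('a, 'm) based_poset_scheme"
  assumes polytope: "abstract_polytope n P" and finite_faces: "finite (faces P)"
begin

section \<open>Flags as chains with one face of each rank\<close>

lemma order_facts:
  shows le_faces: "\<And>F G. (F, G) \<in> face_le P \<Longrightarrow> F \<in> faces P \<and> G \<in> faces P"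
    and le_refl: "\<And>F. F \<in> faces P \<Longrightarrow> (F, F) \<in> face_le P"
    and le_trans: "\<And>F G H. (F, G) \<in> face_le P \<Longrightarrow> (G, H) \<in> face_le P \<Longrightarrow> (F, H) \<in> face_le P"
    and rank_range: "\<And>F. F \<in> faces P \<Longrightarrow> face_rank P F \<in> {-1..int n}"
    and le_rank: "\<And>F G. (F, G) \<in> face_le P \<Longrightarrow> F \<noteq> G \<Longrightarrow> face_rank P F < face_rank P G"
  using polytope
  unfolding abstract_polytope_def ranked_bounded_def partial_order_on_def preorder_on_def
    refl_on_def
  by (auto dest: transD)

lemma Chains_faces: "C \<in> Chains (face_le P) \<Longrightarrow> C \<subseteq> faces P"
  using le_faces by (auto simp: Chains_def)

lemma inj_on_rank: "C \<in> Chains (face_le P) \<Longrightarrow> inj_on (face_rank P) C"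
  using le_rank by (fastforce simp: Chains_def inj_on_def)

lemma card_Chains_le: "C \<in> Chains (face_le P) \<Longrightarrow> card C \<le> n + 2"
proof -
  assume C: "C \<in> Chains (face_le P)"
  have "card C = card (face_rank P ` C)" using inj_on_rank[OF C] by (simp add: card_image)
  also have "\<dots> \<le> card {-1..int n}"
    using rank_range Chains_faces[OF C] by (intro card_mono) auto
  finally show ?thesis by simp
qed

text \<open>The rank is injective on a chain and takes at most n + 2 values, so a chain of that
  length cannot grow.\<close>

lemma flagI:
  assumes "C \<in> Chains (face_le P)" "card C = n + 2"
  shows "C \<in> flags P"
proof -
  have "D = C" if D: "D \<in> Chains (face_le P)" "C \<subseteq> D" for D
  proof -
    have "finite D" using D Chains_faces finite_faces finite_subset by blast
    then show ?thesis using card_seteq[OF _ D(2)] card_Chains_le[OF D(1)] assms(2) by simp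
  qed
  then show ?thesis using assms by (auto simp: flags_def)
qed

lemma card_flag: "\<Phi> \<in> flags P \<Longrightarrow> card \<Phi> = n + 2"
  using polytope by (simp add: abstract_polytope_def)

lemma base_flag: "base P \<in> flags P"
  using polytope by (simp add: abstract_polytope_def)

lemma flag_faces: "\<Phi> \<in> flags P \<Longrightarrow> \<Phi> \<subseteq> faces P"
  using Chains_faces flags_subset_Chains by blast

lemma rank_image_flag:
  assumes "\<Phi> \<in> flags P"
  shows "face_rank P ` \<Phi> = {-1..int n}"
proof (rule card_subset_eq)
  show "face_rank P ` \<Phi> \<subseteq> {-1..int n}" using rank_range flag_faces[OF assms] by blast
  show "card (face_rank P ` \<Phi>) = card {-1..int n}"
    using card_image[OF inj_on_rank[OF flags_subset_Chains[OF assms]]] card_flag[OF assms] by simp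
qed simp

lemma face_at_eqI:
  assumes "\<Phi> \<in> flags P" "F \<in> \<Phi>" "face_rank P F = j"
  shows "face_at P \<Phi> j = F"
  unfolding face_at_def
  using assms inj_on_rank[OF flags_subset_Chains[OF assms(1)]]
  by (intro the_equality) (auto simp: inj_on_def)

lemma face_at:
  assumes "\<Phi> \<in> flags P" "j \<in> {-1..int n}"
  shows "face_at P \<Phi> j \<in> \<Phi>" "face_rank P (face_at P \<Phi> j) = j"
proof -
  obtain F where "F \<in> \<Phi>" "face_rank P F = j"
    using rank_image_flag[OF assms(1)] assms(2) by (metis imageE)
  then show "face_at P \<Phi> j \<in> \<Phi>" "face_rank P (face_at P \<Phi> j) = j"
    using face_at_eqI[OF assms(1)] by auto
qed

lemma face_at_rank:
  assumes "\<Phi> \<in> flags P" "F \<in> \<Phi>"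
  shows "face_rank P F \<in> {-1..int n}" "face_at P \<Phi> (face_rank P F) = F"
  using assms rank_range flag_faces face_at_eqI by blast+

lemma flag_eqI:
  assumes "\<Phi> \<in> flags P" "\<Psi> \<in> flags P" "\<And>m. m \<in> {-1..int n} \<Longrightarrow> face_at P \<Phi> m = face_at P \<Psi> m"
  shows "\<Phi> = \<Psi>"
  using assms face_at_rank face_at(1) by (metis subsetI subset_antisym)

lemma flag_le_iff:
  assumes "\<Phi> \<in> flags P" "F \<in> \<Phi>" "G \<in> \<Phi>"
  shows "(F, G) \<in> face_le P \<longleftrightarrow> face_rank P F \<le> face_rank P G"
proof -
  have "(F, G) \<in> face_le P \<or> (G, F) \<in> face_le P"
    using flags_subset_Chains[OF assms(1)] assms by (auto simp: Chains_def)
  moreover have "(F, F) \<in> face_le P" using le_refl flag_faces assms by blast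
  ultimately show ?thesis using le_rank[of F G] le_rank[of G F] by fastforce
qed

lemma flag_agree_iff:
  assumes "\<Phi> \<in> flags P" "\<Psi> \<in> flags P"
  shows "{F \<in> \<Psi>. face_rank P F \<noteq> j} = {F \<in> \<Phi>. face_rank P F \<noteq> j} \<longleftrightarrow>
    (\<forall>m \<in> {-1..int n}. m \<noteq> j \<longrightarrow> face_at P \<Psi> m = face_at P \<Phi> m)" (is "?L = ?R \<longleftrightarrow> _")
proof
  assume eq: "?L = ?R"
  show "\<forall>m \<in> {-1..int n}. m \<noteq> j \<longrightarrow> face_at P \<Psi> m = face_at P \<Phi> m"
  proof (intro ballI impI)
    fix m assume m: "m \<in> {-1..int n}" "m \<noteq> j"
    have "face_at P \<Phi> m \<in> ?R" using face_at[OF assms(1) m(1)] m by simp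
    then have "face_at P \<Phi> m \<in> \<Psi>" using eq by auto
    then show "face_at P \<Psi> m = face_at P \<Phi> m"
      using face_at_eqI[OF assms(2)] face_at(2)[OF assms(1) m(1)] by blast
  qed
next
  assume eq: "\<forall>m \<in> {-1..int n}. m \<noteq> j \<longrightarrow> face_at P \<Psi> m = face_at P \<Phi> m"
  have "F \<in> \<Psi> \<longleftrightarrow> F \<in> \<Phi>" if "face_rank P F \<noteq> j" for F
    using that eq assms face_at_rank face_at(1) by metis
  then show "?L = ?R" by blast
qed

lemma Chain_extends_to_flag:
  assumes "C \<in> Chains (face_le P)"
  obtains \<Phi> where "\<Phi> \<in> flags P" "C \<subseteq> \<Phi>"
proof -
  have "Chains (face_le P) \<subseteq> Pow (faces P)" using Chains_faces by blast
  then have "finite (Chains (face_le P))" using finite_faces finite_subset by blast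
  from finite_has_maximal2[OF this assms] show thesis
    using that by (auto simp: flags_def)
qed

lemma face_in_flag:
  assumes "F \<in> faces P"
  obtains \<Phi> where "\<Phi> \<in> flags P" "F \<in> \<Phi>"
proof -
  have "{F} \<in> Chains (face_le P)" using le_refl[OF assms] by (simp add: Chains_def)
  then show thesis using that by (elim Chain_extends_to_flag) auto
qed

section \<open>Adjacent flags\<close>

lemma diamond:
  assumes "\<Phi> \<in> flags P" "j \<in> {0..<int n}"
  obtains H' where "{H \<in> faces P. face_rank P H = j \<and> (face_at P \<Phi> (j - 1), H) \<in> face_le P \<and>
      (H, face_at P \<Phi> (j + 1)) \<in> face_le P} = {face_at P \<Phi> j, H'}" "H' \<noteq> face_at P \<Phi> j"
proof -
  let ?S = "{H \<in> faces P. face_rank P H = j \<and> (face_at P \<Phi> (j - 1), H) \<in> face_le P \<and>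
      (H, face_at P \<Phi> (j + 1)) \<in> face_le P}"
  have m: "j - 1 \<in> {-1..int n}" "j \<in> {-1..int n}" "j + 1 \<in> {-1..int n}" using assms(2) by auto
  note at = face_at[OF assms(1) m(1)] face_at[OF assms(1) m(2)] face_at[OF assms(1) m(3)]
  have "card ?S = 2"
    using polytope at flag_le_iff[OF assms(1) at(1) at(5)]
    unfolding abstract_polytope_def diamond_condition_def by simp
  moreover have "face_at P \<Phi> j \<in> ?S"
    using at flag_le_iff[OF assms(1) at(1) at(3)] flag_le_iff[OF assms(1) at(3) at(5)]
      flag_faces[OF assms(1)] by auto
  ultimately obtain a b where "?S = {a, b}" "a \<noteq> b" "face_at P \<Phi> j \<in> {a, b}"
    unfolding card_2_iff by blast
  then show thesis using that[of a] that[of b] by (metis doubleton_eq_iff empty_iff insert_iff)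
qed

text \<open>Both j-faces are the second element of the same two-element set. Agreement is asked for
  at the neighbouring ranks alone, so that the lemma applies to flags that also differ further away,
  as in \<open>adj_flag_commute\<close>.\<close>

lemma diamond_unique:
  assumes "\<Phi> \<in> flags P" "\<Psi> \<in> flags P" "\<Omega> \<in> flags P" and j: "j \<in> {0..<int n}"
    and "face_at P \<Psi> j \<noteq> face_at P \<Phi> j" "face_at P \<Omega> j \<noteq> face_at P \<Phi> j"
    and "\<And>m. m \<in> {j - 1, j + 1} \<Longrightarrow> face_at P \<Psi> m = face_at P \<Phi> m"
    and "\<And>m. m \<in> {j - 1, j + 1} \<Longrightarrow> face_at P \<Omega> m = face_at P \<Phi> m"
  shows "face_at P \<Psi> j = face_at P \<Omega> j"
proof -
  let ?S = "{H \<in> faces P. face_rank P H = j \<and> (face_at P \<Phi> (j - 1), H) \<in> face_le P \<and>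
      (H, face_at P \<Phi> (j + 1)) \<in> face_le P}"
  have S: "face_at P \<Theta> j \<in> ?S"
    if \<Theta>: "\<Theta> \<in> flags P" and eq: "\<And>m. m \<in> {j - 1, j + 1} \<Longrightarrow> face_at P \<Theta> m = face_at P \<Phi> m" for \<Theta>
  proof -
    have m: "j - 1 \<in> {-1..int n}" "j \<in> {-1..int n}" "j + 1 \<in> {-1..int n}" using j by auto
    note at = face_at[OF \<Theta> m(1)] face_at[OF \<Theta> m(2)] face_at[OF \<Theta> m(3)]
    show ?thesis
      using at flag_le_iff[OF \<Theta> at(1) at(3)] flag_le_iff[OF \<Theta> at(3) at(5)]
        flag_faces[OF \<Theta>] eq[of "j - 1"] eq[of "j + 1"] by auto
  qed
  obtain H' where "?S = {face_at P \<Phi> j, H'}" using diamond[OF assms(1) j] .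
  then show ?thesis using S[OF assms(2,7)] S[OF assms(3,8)] assms(5,6) by auto
qed

text \<open>Justifies the description in \<open>adj_flag\<close>: exchanging the j-face for the
  other one granted by the diamond condition gives existence, and having just two candidates gives
  uniqueness.\<close>

lemma ex1_adjacent_flag:
  assumes \<Phi>: "\<Phi> \<in> flags P" and j: "j \<in> {0..<int n}"
  shows "\<exists>!\<Psi>. \<Psi> \<in> flags P \<and> \<Psi> \<noteq> \<Phi> \<and>
     {F \<in> \<Psi>. face_rank P F \<noteq> j} = {F \<in> \<Phi>. face_rank P F \<noteq> j}"
proof (rule ex_ex1I)
  have m: "j - 1 \<in> {-1..int n}" "j \<in> {-1..int n}" "j + 1 \<in> {-1..int n}" using j by auto
  note at = face_at[OF \<Phi> m(1)] face_at[OF \<Phi> m(2)] face_at[OF \<Phi> m(3)]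
  obtain H where H: "H \<noteq> face_at P \<Phi> j"
    and "{H \<in> faces P. face_rank P H = j \<and> (face_at P \<Phi> (j - 1), H) \<in> face_le P \<and>
      (H, face_at P \<Phi> (j + 1)) \<in> face_le P} = {face_at P \<Phi> j, H}"
    using diamond[OF \<Phi> j] .
  then have H_face: "H \<in> faces P" and H_rank: "face_rank P H = j"
    and H_le: "(face_at P \<Phi> (j - 1), H) \<in> face_le P" "(H, face_at P \<Phi> (j + 1)) \<in> face_le P"
    by blast+
  have "H \<notin> \<Phi>" using face_at_eqI[OF \<Phi> _ H_rank] H by blast
  define \<Psi> where "\<Psi> = insert H (\<Phi> - {face_at P \<Phi> j})"
  \<comment> \<open>A face of another rank lies below the (j-1)-face or above the (j+1)-face, hence
    is comparable with \<open>H\<close> by transitivity.\<close>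
  have cmp: "(K, H) \<in> face_le P \<or> (H, K) \<in> face_le P" if K: "K \<in> \<Phi> - {face_at P \<Phi> j}" for K
  proof -
    have "face_rank P K \<noteq> j" using K face_at_eqI[OF \<Phi>, of K j] by auto
    then consider "face_rank P K \<le> j - 1" | "face_rank P K \<ge> j + 1" by linarith
    then show ?thesis
    proof cases
      case 1
      then have "(K, face_at P \<Phi> (j - 1)) \<in> face_le P"
        using K at flag_le_iff[OF \<Phi>] by auto
      then show ?thesis using H_le le_trans by blast
    next
      case 2
      then have "(face_at P \<Phi> (j + 1), K) \<in> face_le P"
        using K at flag_le_iff[OF \<Phi>] by auto
      then show ?thesis using H_le le_trans by blast
    qed
  qed
  have "\<Psi> \<in> Chains (face_le P)"
    using flags_subset_Chains[OF \<Phi>] cmp le_refl[OF H_face] by (auto simp: Chains_def \<Psi>_def)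
  moreover have "finite \<Phi>" using flag_faces[OF \<Phi>] finite_faces finite_subset by blast
  then have "card \<Psi> = n + 2"
    using \<open>H \<notin> \<Phi>\<close> at(3) card_flag[OF \<Phi>] by (simp add: \<Psi>_def)
  ultimately have "\<Psi> \<in> flags P" by (rule flagI)
  moreover have "\<Psi> \<noteq> \<Phi>" using \<open>H \<notin> \<Phi>\<close> by (auto simp: \<Psi>_def)
  moreover have "{F \<in> \<Psi>. face_rank P F \<noteq> j} = {F \<in> \<Phi>. face_rank P F \<noteq> j}"
    using H_rank at(4) by (auto simp: \<Psi>_def)
  ultimately show "\<exists>\<Psi>. \<Psi> \<in> flags P \<and> \<Psi> \<noteq> \<Phi> \<and>
     {F \<in> \<Psi>. face_rank P F \<noteq> j} = {F \<in> \<Phi>. face_rank P F \<noteq> j}" by blast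
next
  fix \<Psi> \<Omega>
  assume A: "\<Psi> \<in> flags P \<and> \<Psi> \<noteq> \<Phi> \<and> {F \<in> \<Psi>. face_rank P F \<noteq> j} = {F \<in> \<Phi>. face_rank P F \<noteq> j}"
    and B: "\<Omega> \<in> flags P \<and> \<Omega> \<noteq> \<Phi> \<and> {F \<in> \<Omega>. face_rank P F \<noteq> j} = {F \<in> \<Phi>. face_rank P F \<noteq> j}"
  have "\<forall>m \<in> {-1..int n}. m \<noteq> j \<longrightarrow> face_at P \<Psi> m = face_at P \<Phi> m"
    "\<forall>m \<in> {-1..int n}. m \<noteq> j \<longrightarrow> face_at P \<Omega> m = face_at P \<Phi> m"
    using A B by (simp_all only: flip: flag_agree_iff[OF \<Phi>])
  then have eqA: "face_at P \<Psi> m = face_at P \<Phi> m" and eqB: "face_at P \<Omega> m = face_at P \<Phi> m"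
    if "m \<in> {-1..int n}" "m \<noteq> j" for m
    using that by auto
  have "face_at P \<Psi> j \<noteq> face_at P \<Phi> j" using flag_eqI[of \<Psi> \<Phi>] A \<Phi> eqA by blast
  moreover have "face_at P \<Omega> j \<noteq> face_at P \<Phi> j" using flag_eqI[of \<Omega> \<Phi>] B \<Phi> eqB by blast
  ultimately have "face_at P \<Psi> j = face_at P \<Omega> j"
  proof (intro diamond_unique[OF \<Phi> _ _ j])
    fix m assume "m \<in> {j - 1, j + 1}"
    then have "m \<in> {-1..int n}" "m \<noteq> j" using j by auto
    then show "face_at P \<Psi> m = face_at P \<Phi> m" "face_at P \<Omega> m = face_at P \<Phi> m"
      by (rule eqA, rule eqB)
  qed (use A B in auto)
  then have "face_at P \<Psi> m = face_at P \<Omega> m" if "m \<in> {-1..int n}" for m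
    using eqA[OF that] eqB[OF that] by (cases "m = j") auto
  then show "\<Psi> = \<Omega>" using flag_eqI[of \<Psi> \<Omega>] A B by blast
qed

lemma adj_flag:
  assumes "\<Phi> \<in> flags P" "j \<in> {0..<int n}"
  shows adj_flag_flag: "adj_flag P j \<Phi> \<in> flags P"
    and adj_flag_neq: "adj_flag P j \<Phi> \<noteq> \<Phi>"
    and adj_flag_face_at: "\<And>m. m \<in> {-1..int n} \<Longrightarrow> m \<noteq> j \<Longrightarrow> face_at P (adj_flag P j \<Phi>) m = face_at P \<Phi> m"
proof -
  have "adj_flag P j \<Phi> \<in> flags P \<and> adj_flag P j \<Phi> \<noteq> \<Phi> \<and>
     {F \<in> adj_flag P j \<Phi>. face_rank P F \<noteq> j} = {F \<in> \<Phi>. face_rank P F \<noteq> j}"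
    unfolding adj_flag_def by (rule theI'[OF ex1_adjacent_flag[OF assms]])
  then show "adj_flag P j \<Phi> \<in> flags P" "adj_flag P j \<Phi> \<noteq> \<Phi>"
    "\<And>m. m \<in> {-1..int n} \<Longrightarrow> m \<noteq> j \<Longrightarrow> face_at P (adj_flag P j \<Phi>) m = face_at P \<Phi> m"
    using flag_agree_iff[OF assms(1)] by blast+
qed

lemma adj_flag_eqI:
  assumes "\<Phi> \<in> flags P" "j \<in> {0..<int n}" "\<Psi> \<in> flags P" "\<Psi> \<noteq> \<Phi>"
    and "\<And>m. m \<in> {-1..int n} \<Longrightarrow> m \<noteq> j \<Longrightarrow> face_at P \<Psi> m = face_at P \<Phi> m"
  shows "adj_flag P j \<Phi> = \<Psi>"
  unfolding adj_flag_def
  using assms(3-5) flag_agree_iff[OF assms(1,3)]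
  by (intro the1_equality[OF ex1_adjacent_flag[OF assms(1,2)]]) blast

lemma adj_flag_face_at_neq:
  assumes "\<Phi> \<in> flags P" "j \<in> {0..<int n}"
  shows "face_at P (adj_flag P j \<Phi>) j \<noteq> face_at P \<Phi> j"
  using flag_eqI[OF adj_flag_flag[OF assms] assms(1)] adj_flag[OF assms] by blast

lemma adj_flag_involution:
  assumes "\<Phi> \<in> flags P" "j \<in> {0..<int n}"
  shows "adj_flag P j (adj_flag P j \<Phi>) = \<Phi>"
  using assms adj_flag[OF assms] by (intro adj_flag_eqI) auto

text \<open>The new i-face is determined by the old one and the faces of ranks i - 1 and i + 1, and
  these survive a change at a rank j at distance at least 2.\<close>

lemma adj_flag_commute:
  assumes \<Phi>: "\<Phi> \<in> flags P" and i: "i \<in> {0..<int n}" and j: "j \<in> {0..<int n}" and ij: "\<bar>i - j\<bar> \<ge> 2"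
  shows "adj_flag P i (adj_flag P j \<Phi>) = adj_flag P j (adj_flag P i \<Phi>)"
proof -
  note ai = adj_flag[OF \<Phi> i] and aj = adj_flag[OF \<Phi> j]
  note aij = adj_flag[OF aj(1) i]
  have "adj_flag P j (adj_flag P i \<Phi>) = adj_flag P i (adj_flag P j \<Phi>)"
  proof (rule adj_flag_eqI[OF ai(1) j aij(1)])
    have "face_at P (adj_flag P i (adj_flag P j \<Phi>)) j = face_at P (adj_flag P j \<Phi>) j"
      "face_at P (adj_flag P i \<Phi>) j = face_at P \<Phi> j"
      using ij j by (auto intro!: aij(3) ai(3))
    then show "adj_flag P i (adj_flag P j \<Phi>) \<noteq> adj_flag P i \<Phi>"
      using adj_flag_face_at_neq[OF \<Phi> j] by metis
    \<comment> \<open>At rank i both flags differ from \<open>\<Phi>\<close>, yet they agree with it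
      at the two neighbouring ranks, so both carry the second face of the diamond.\<close>
    have same: "face_at P (adj_flag P i (adj_flag P j \<Phi>)) i = face_at P (adj_flag P i \<Phi>) i"
    proof (rule diamond_unique[OF \<Phi> aij(1) ai(1) i])
      have "face_at P (adj_flag P j \<Phi>) i = face_at P \<Phi> i" using ij i by (auto intro!: aj(3))
      then show "face_at P (adj_flag P i (adj_flag P j \<Phi>)) i \<noteq> face_at P \<Phi> i"
        using adj_flag_face_at_neq[OF aj(1) i] by simp
      show "face_at P (adj_flag P i \<Phi>) i \<noteq> face_at P \<Phi> i" by (rule adj_flag_face_at_neq[OF \<Phi> i])
    next
      fix m assume "m \<in> {i - 1, i + 1}"
      then have m: "m \<in> {-1..int n}" "m \<noteq> i" "m \<noteq> j" using i ij by auto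
      show "face_at P (adj_flag P i (adj_flag P j \<Phi>)) m = face_at P \<Phi> m"
        using aij(3)[OF m(1,2)] aj(3)[OF m(1,3)] by simp
      show "face_at P (adj_flag P i \<Phi>) m = face_at P \<Phi> m" using ai(3)[OF m(1,2)] .
    qed
    fix m assume m: "m \<in> {-1..int n}" "m \<noteq> j"
    show "face_at P (adj_flag P i (adj_flag P j \<Phi>)) m = face_at P (adj_flag P i \<Phi>) m"
      using same aij(3)[OF m(1)] aj(3)[OF m] ai(3)[OF m(1)] by (cases "m = i") auto
  qed
  then show ?thesis by simp
qed

lemma adjacent_adj_flag:
  assumes "\<Phi> \<in> flags P" "j \<in> {0..<int n}"
  shows "adjacent P \<Phi> (adj_flag P j \<Phi>)"
proof -
  have diff: "\<Psi> - \<Omega> = {face_at P \<Psi> j}"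
    if "\<Psi> \<in> flags P" "\<Omega> \<in> flags P" "face_at P \<Psi> j \<noteq> face_at P \<Omega> j"
      "\<And>m. m \<in> {-1..int n} \<Longrightarrow> m \<noteq> j \<Longrightarrow> face_at P \<Psi> m = face_at P \<Omega> m" for \<Psi> \<Omega>
  proof -
    have j: "j \<in> {-1..int n}" using assms(2) by auto
    have "face_at P \<Psi> j \<notin> \<Omega>"
      using that(3) face_at_eqI[OF that(2)] face_at(2)[OF that(1) j] by metis
    moreover have "F \<in> \<Omega>" if "F \<in> \<Psi>" "F \<noteq> face_at P \<Psi> j" for F
      using that \<open>\<Psi> \<in> flags P\<close> \<open>\<Omega> \<in> flags P\<close> face_at_rank face_at(1)
        \<open>\<And>m. m \<in> {-1..int n} \<Longrightarrow> m \<noteq> j \<Longrightarrow> face_at P \<Psi> m = face_at P \<Omega> m\<close> by metis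
    ultimately show ?thesis using face_at(1)[OF that(1) j] by blast
  qed
  note a = adj_flag[OF assms] and b = adj_flag_face_at_neq[OF assms]
  have "\<Phi> - adj_flag P j \<Phi> = {face_at P \<Phi> j}"
    using a b assms(1) by (intro diff) auto
  moreover have "adj_flag P j \<Phi> - \<Phi> = {face_at P (adj_flag P j \<Phi>) j}"
    using a b assms(1) by (intro diff) auto
  ultimately show ?thesis using assms a by (simp add: adjacent_def)
qed

lemma extreme_face_at_eq:
  assumes "\<Phi> \<in> flags P" "\<Psi> \<in> flags P" "j = -1 \<or> j = int n"
  shows "face_at P \<Phi> j = face_at P \<Psi> j"
proof -
  have "\<exists>B \<in> faces P. face_rank P B = -1 \<and> (\<forall>G \<in> faces P. (B, G) \<in> face_le P)"
    and "\<exists>T \<in> faces P. face_rank P T = int n \<and> (\<forall>G \<in> faces P. (G, T) \<in> face_le P)"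
    using polytope by (simp_all add: abstract_polytope_def ranked_bounded_def)
  then obtain B T where B: "face_rank P B = -1" "\<forall>G \<in> faces P. (B, G) \<in> face_le P"
    and T: "face_rank P T = int n" "\<forall>G \<in> faces P. (G, T) \<in> face_le P"
    by (elim bexE conjE)
  have "F = B" if "F \<in> faces P" "face_rank P F = -1" for F
    using le_rank[OF bspec[OF B(2) that(1)]] B(1) that(2) by force
  moreover have "F = T" if "F \<in> faces P" "face_rank P F = int n" for F
    using le_rank[OF bspec[OF T(2) that(1)]] T(1) that(2) by force
  moreover have "j \<in> {-1..int n}" using assms(3) by auto
  then have "face_at P \<Theta> j \<in> faces P" "face_rank P (face_at P \<Theta> j) = j" if "\<Theta> \<in> flags P" for \<Theta>
    using that face_at flag_faces by blast+
  ultimately show ?thesis using assms by metis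
qed

text \<open>\<open>adjacent\<close> mentions no rank. The exchanged face supplies it, and that rank
  is neither -1 nor n because all flags share the extreme faces.\<close>

lemma adjacent_imp_adj_flag:
  assumes "adjacent P \<Phi> \<Psi>"
  obtains j where "j \<in> {0..<int n}" "\<Psi> = adj_flag P j \<Phi>"
proof -
  have \<Phi>: "\<Phi> \<in> flags P" and \<Psi>: "\<Psi> \<in> flags P" using assms by (auto simp: adjacent_def)
  obtain F where F: "\<Phi> - \<Psi> = {F}" using assms card_1_singletonE by (auto simp: adjacent_def)
  define j where "j = face_rank P F"
  have "F \<in> \<Phi>" "F \<notin> \<Psi>" using F by auto
  then have j: "j \<in> {-1..int n}" and Fj: "face_at P \<Phi> j = F"
    using face_at_rank[OF \<Phi>] by (auto simp: j_def)
  have "face_at P \<Psi> j \<noteq> F" using face_at(1)[OF \<Psi> j] \<open>F \<notin> \<Psi>\<close> by metis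
  then have "j \<noteq> -1 \<and> j \<noteq> int n" using extreme_face_at_eq[OF \<Phi> \<Psi>] Fj by metis
  then have j': "j \<in> {0..<int n}" using j by auto
  have "face_at P \<Psi> m = face_at P \<Phi> m" if m: "m \<in> {-1..int n}" "m \<noteq> j" for m
  proof -
    have "face_at P \<Phi> m \<noteq> F" using face_at(2)[OF \<Phi> m(1)] m(2) j_def by metis
    then have "face_at P \<Phi> m \<in> \<Psi>" using face_at(1)[OF \<Phi> m(1)] F by blast
    then show ?thesis using face_at_eqI[OF \<Psi>] face_at(2)[OF \<Phi> m(1)] by metis
  qed
  moreover have "\<Psi> \<noteq> \<Phi>" using F by auto
  ultimately have "adj_flag P j \<Phi> = \<Psi>" using \<Phi> \<Psi> j' by (intro adj_flag_eqI) auto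
  then show thesis using that j' by blast
qed

section \<open>The action of automorphisms on flags\<close>

lemma
  assumes f: "f \<in> carrier (aut_group P)"
  shows aut_inj: "inj_on f (faces P)"
    and aut_le: "\<And>F G. F \<in> faces P \<Longrightarrow> G \<in> faces P \<Longrightarrow> (f F, f G) \<in> face_le P \<longleftrightarrow> (F, G) \<in> face_le P"
    and aut_extensional: "f \<in> extensional (faces P)"
  using f by (simp_all add: carrier_aut_group Bij_def bij_betw_def)

lemma aut_flag:
  assumes f: "f \<in> carrier (aut_group P)" and \<Phi>: "\<Phi> \<in> flags P"
  shows "f ` \<Phi> \<in> flags P"
proof (rule flagI)
  show "f ` \<Phi> \<in> Chains (face_le P)"
    using flags_subset_Chains[OF \<Phi>] aut_le[OF f] flag_faces[OF \<Phi>]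
    by (auto simp: Chains_def subset_iff)
  show "card (f ` \<Phi>) = n + 2"
    using card_image[OF inj_on_subset[OF aut_inj[OF f] flag_faces[OF \<Phi>]]] card_flag[OF \<Phi>] by simp
qed

text \<open>Recovers the rank of a face from the order alone, which is all that
  \<open>aut_group\<close> asks to be preserved. The offset 2 comes from ranks starting at -1 and
  from \<open>F\<close> itself being counted.\<close>

lemma card_below_in_flag:
  assumes \<Phi>: "\<Phi> \<in> flags P" and F: "F \<in> \<Phi>"
  shows "int (card {G \<in> \<Phi>. (G, F) \<in> face_le P}) = face_rank P F + 2"
proof -
  have "face_rank P ` {G \<in> \<Phi>. (G, F) \<in> face_le P} = {-1..face_rank P F}"
  proof (intro equalityI subsetI)
    fix m assume "m \<in> {-1..face_rank P F}"
    then have m: "m \<in> {-1..int n}" "m \<le> face_rank P F" using face_at_rank(1)[OF \<Phi> F] by auto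
    then show "m \<in> face_rank P ` {G \<in> \<Phi>. (G, F) \<in> face_le P}"
      using face_at[OF \<Phi> m(1)] flag_le_iff[OF \<Phi> face_at(1)[OF \<Phi> m(1)] F]
      by (intro image_eqI[of _ _ "face_at P \<Phi> m"]) auto
  qed (use flag_le_iff[OF \<Phi> _ F] face_at_rank(1)[OF \<Phi>] in auto)
  moreover have "inj_on (face_rank P) {G \<in> \<Phi>. (G, F) \<in> face_le P}"
    by (rule inj_on_subset[OF inj_on_rank[OF flags_subset_Chains[OF \<Phi>]]]) auto
  ultimately have "card {G \<in> \<Phi>. (G, F) \<in> face_le P} = card {-1..face_rank P F}"
    by (metis card_image)
  then show ?thesis using face_at_rank(1)[OF \<Phi> F] by simp
qed

lemma aut_rank:
  assumes f: "f \<in> carrier (aut_group P)" and F: "F \<in> faces P"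
  shows "face_rank P (f F) = face_rank P F"
proof -
  obtain \<Phi> where \<Phi>: "\<Phi> \<in> flags P" "F \<in> \<Phi>" using face_in_flag[OF F] .
  have "{G \<in> f ` \<Phi>. (G, f F) \<in> face_le P} = f ` {G \<in> \<Phi>. (G, F) \<in> face_le P}"
    using aut_le[OF f] flag_faces[OF \<Phi>(1)] F by (auto simp: subset_iff)
  moreover have "inj_on f {G \<in> \<Phi>. (G, F) \<in> face_le P}"
    by (rule inj_on_subset[OF aut_inj[OF f]]) (use flag_faces[OF \<Phi>(1)] in auto)
  ultimately have "card {G \<in> f ` \<Phi>. (G, f F) \<in> face_le P} = card {G \<in> \<Phi>. (G, F) \<in> face_le P}"
    by (simp add: card_image)
  then show ?thesis
    using card_below_in_flag[OF \<Phi>] card_below_in_flag[OF aut_flag[OF f \<Phi>(1)], of "f F"] \<Phi>(2) by simp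
qed

lemma aut_face_at:
  assumes f: "f \<in> carrier (aut_group P)" and \<Phi>: "\<Phi> \<in> flags P" and m: "m \<in> {-1..int n}"
  shows "face_at P (f ` \<Phi>) m = f (face_at P \<Phi> m)"
proof (rule face_at_eqI[OF aut_flag[OF f \<Phi>]])
  show "f (face_at P \<Phi> m) \<in> f ` \<Phi>" using face_at(1)[OF \<Phi> m] by blast
  show "face_rank P (f (face_at P \<Phi> m)) = m"
    using face_at[OF \<Phi> m] flag_faces[OF \<Phi>] aut_rank[OF f] by auto
qed

text \<open>Automorphisms preserve ranks, so the image of the adjacent flag differs from the image
  flag at rank j only; uniqueness of the adjacent flag does the rest.\<close>

lemma aut_adj_flag:
  assumes f: "f \<in> carrier (aut_group P)" and \<Phi>: "\<Phi> \<in> flags P" and j: "j \<in> {0..<int n}"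
  shows "f ` adj_flag P j \<Phi> = adj_flag P j (f ` \<Phi>)"
proof -
  note a = adj_flag[OF \<Phi> j]
  have "adj_flag P j (f ` \<Phi>) = f ` adj_flag P j \<Phi>"
  proof (rule adj_flag_eqI[OF aut_flag[OF f \<Phi>] j aut_flag[OF f a(1)]])
    show "f ` adj_flag P j \<Phi> \<noteq> f ` \<Phi>"
      using inj_on_image_eq_iff[OF aut_inj[OF f] flag_faces[OF a(1)] flag_faces[OF \<Phi>]] a(2) by simp
    show "face_at P (f ` adj_flag P j \<Phi>) m = face_at P (f ` \<Phi>) m"
      if "m \<in> {-1..int n}" "m \<noteq> j" for m
      using aut_face_at[OF f] a(1) \<Phi> a(3)[OF that] that by simp
  qed
  then show ?thesis by simp
qed

text \<open>The action on flags is free. Agreement spreads along adjacencies by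
  \<open>aut_adj_flag\<close>, hence to all flags by connectedness, and the image of a flag
  determines the images of its faces through their ranks.\<close>

lemma aut_eqI:
  assumes f: "f \<in> carrier (aut_group P)" and g: "g \<in> carrier (aut_group P)"
    and \<Phi>: "\<Phi> \<in> flags P" and eq: "f ` \<Phi> = g ` \<Phi>"
  shows "f = g"
proof (rule extensionalityI[OF aut_extensional[OF f] aut_extensional[OF g]])
  have all: "f ` \<Psi> = g ` \<Psi>" if "\<Psi> \<in> flags P" for \<Psi>
  proof -
    have "(\<Phi>, \<Psi>) \<in> {(A, B). adjacent P A B \<and> \<Phi> \<inter> \<Psi> \<subseteq> A \<and> \<Phi> \<inter> \<Psi> \<subseteq> B}\<^sup>*"
      using polytope \<Phi> that unfolding abstract_polytope_def strongly_flag_connected_def by blast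
    then show ?thesis
    proof (induction rule: rtrancl_induct)
      case (step A B)
      then have AB: "adjacent P A B" by simp
      then have A: "A \<in> flags P" by (simp add: adjacent_def)
      obtain j where "j \<in> {0..<int n}" "B = adj_flag P j A" using adjacent_imp_adj_flag[OF AB] .
      then show ?case using aut_adj_flag[OF f A] aut_adj_flag[OF g A] step.IH by simp
    qed (rule eq)
  qed
  fix F assume F: "F \<in> faces P"
  obtain \<Psi> where \<Psi>: "\<Psi> \<in> flags P" "F \<in> \<Psi>" using face_in_flag[OF F] .
  have m: "face_rank P F \<in> {-1..int n}" and "face_at P \<Psi> (face_rank P F) = F"
    using face_at_rank[OF \<Psi>] .
  then show "f F = g F"
    using aut_face_at[OF f \<Psi>(1) m] aut_face_at[OF g \<Psi>(1) m] all[OF \<Psi>(1)] by simp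
qed

end

section \<open>Rotations\<close>

locale finite_chiral_polytope = finite_polytope n P for n :: nat and P :: "'a based_poset" +
  assumes chiral: "chiral P"
begin

text \<open>There are two orbits and each adjacency changes the orbit, so two adjacencies lead back
  to the first one.\<close>

lemma ex_aut_adj_adj_flag:
  assumes \<Phi>: "\<Phi> \<in> flags P" and i: "i \<in> {0..<int n}" and j: "j \<in> {0..<int n}"
  shows "\<exists>f \<in> carrier (aut_group P). f ` \<Phi> = adj_flag P j (adj_flag P i \<Phi>)"
proof -
  let ?o = "orbit (aut_group P) (\<lambda>f \<Phi>. f ` \<Phi>)"
  interpret group "aut_group P" by (rule group_aut_group)
  define \<Psi> where "\<Psi> = adj_flag P i \<Phi>"
  define \<Omega> where "\<Omega> = adj_flag P j \<Psi>"
  have \<Psi>: "\<Psi> \<in> flags P" using adj_flag_flag[OF \<Phi> i] by (simp add: \<Psi>_def)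
  have \<Omega>: "\<Omega> \<in> flags P" using adj_flag_flag[OF \<Psi> j] by (simp add: \<Omega>_def)
  have "adjacent P \<Phi> \<Psi>" "adjacent P \<Psi> \<Omega>"
    using adjacent_adj_flag[OF \<Phi> i] adjacent_adj_flag[OF \<Psi> j] by (simp_all add: \<Psi>_def \<Omega>_def)
  then have neq: "?o \<Phi> \<noteq> ?o \<Psi>" "?o \<Psi> \<noteq> ?o \<Omega>"
    using chiral by (auto simp: chiral_def)
  have mem: "?o \<Phi> \<in> orbits (aut_group P) (flags P) (\<lambda>f \<Phi>. f ` \<Phi>)"
    "?o \<Psi> \<in> orbits (aut_group P) (flags P) (\<lambda>f \<Phi>. f ` \<Phi>)"
    "?o \<Omega> \<in> orbits (aut_group P) (flags P) (\<lambda>f \<Phi>. f ` \<Phi>)"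
    using \<Phi> \<Psi> \<Omega> by (auto simp: orbits_def)
  obtain X Y where "orbits (aut_group P) (flags P) (\<lambda>f \<Phi>. f ` \<Phi>) = {X, Y}"
    using chiral by (auto simp: chiral_def card_2_iff)
  then have "?o \<Phi> = ?o \<Omega>"
    using neq mem by auto
  moreover have "\<one>\<^bsub>aut_group P\<^esub> ` \<Omega> \<in> ?o \<Omega>"
    unfolding orbit_def by blast
  then have "\<Omega> \<in> ?o \<Omega>" using image_one_aut_group[OF flag_faces[OF \<Omega>]] by simp
  ultimately have "\<Omega> \<in> ?o \<Phi>" by simp
  then show ?thesis by (auto simp: orbit_def \<Omega>_def \<Psi>_def)
qed

lemma rot_gen:
  assumes "i \<in> {1..n - 1}"
  shows rot_gen_closed: "rot_gen P i \<in> carrier (aut_group P)"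
    and rot_gen_base: "rot_gen P i ` base P = adj_flag P (int i - 1) (adj_flag P (int i) (base P))"
proof -
  have i: "int i \<in> {0..<int n}" "int i - 1 \<in> {0..<int n}" using assms by auto
  have "\<exists>!f. f \<in> carrier (aut_group P) \<and>
      f ` base P = adj_flag P (int i - 1) (adj_flag P (int i) (base P))"
    using ex_aut_adj_adj_flag[OF base_flag i] aut_eqI[OF _ _ base_flag] by metis
  from theI'[OF this]
  show "rot_gen P i \<in> carrier (aut_group P)"
    "rot_gen P i ` base P = adj_flag P (int i - 1) (adj_flag P (int i) (base P))"
    by (simp_all add: rot_gen_def)
qed

lemma rot_gen_funcset: "rot_gen P \<in> {1..n - 1} \<rightarrow> carrier (aut_group P)"
  using rot_gen_closed by blast

text \<open>Automorphisms commute with passing to adjacent flags, so the factor applied first to the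
  base flag contributes the adjacencies taken last.\<close>

lemma rot_gen_mult_image:
  assumes i: "i \<in> {1..n - 1}" and g: "g \<in> carrier (aut_group P)"
  shows "(rot_gen P i \<otimes>\<^bsub>aut_group P\<^esub> g) ` base P
    = adj_flag P (int i - 1) (adj_flag P (int i) (g ` base P))"
proof -
  have ranks: "int i \<in> {0..<int n}" "int i - 1 \<in> {0..<int n}" using i by auto
  show ?thesis
    using aut_adj_flag[OF g adj_flag_flag[OF base_flag ranks(1)] ranks(2)]
      aut_adj_flag[OF g base_flag ranks(1)] rot_gen_base[OF i]
      image_mult_aut_group[OF flag_faces[OF base_flag]] by simp
qed

text \<open>The rule for \<open>rot_gen P i\<close> is applied to the product itself and solved for
  it by undoing the two involutions in reverse order.\<close>

lemma inv_rot_gen_mult_image: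
  assumes i: "i \<in> {1..n - 1}" and g: "g \<in> carrier (aut_group P)"
  shows "(inv\<^bsub>aut_group P\<^esub> rot_gen P i \<otimes>\<^bsub>aut_group P\<^esub> g) ` base P
    = adj_flag P (int i) (adj_flag P (int i - 1) (g ` base P))"
proof -
  interpret group "aut_group P" by (rule group_aut_group)
  have ranks: "int i \<in> {0..<int n}" "int i - 1 \<in> {0..<int n}" using i by auto
  define h where "h = inv\<^bsub>aut_group P\<^esub> rot_gen P i \<otimes>\<^bsub>aut_group P\<^esub> g"
  have h: "h \<in> carrier (aut_group P)" using g rot_gen_closed[OF i] by (simp add: h_def)
  have hB: "h ` base P \<in> flags P" by (rule aut_flag[OF h base_flag])
  have "rot_gen P i \<otimes>\<^bsub>aut_group P\<^esub> h = g"
    using g rot_gen_closed[OF i] by (simp add: h_def flip: m_assoc)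
  then have "g ` base P = adj_flag P (int i - 1) (adj_flag P (int i) (h ` base P))"
    using rot_gen_mult_image[OF i h] by simp
  then show ?thesis
    using adj_flag_involution[OF adj_flag_flag[OF hB ranks(1)] ranks(2)]
      adj_flag_involution[OF hB ranks(1)] by (simp flip: h_def)
qed

text \<open>Stated for abstract involutions \<open>\<rho>\<close> so that it serves \<open>P\<close>
  and, with ranks reversed, its dual. In a product of consecutive generators the inner adjacencies
  cancel, leaving \<open>\<rho> (i - 1)\<close> applied after \<open>\<rho> j\<close>. These commute
  since \<open>i < j\<close>, so the square fixes the base flag and is trivial by freeness.\<close>

lemma Wplus_relators_word_val:
  assumes x: "x \<in> {1..n - 1} \<rightarrow> carrier (aut_group P)"
    and flag: "\<And>k \<Psi>. k < n \<Longrightarrow> \<Psi> \<in> flags P \<Longrightarrow> \<rho> k \<Psi> \<in> flags P"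
    and invol: "\<And>k \<Psi>. k < n \<Longrightarrow> \<Psi> \<in> flags P \<Longrightarrow> \<rho> k (\<rho> k \<Psi>) = \<Psi>"
    and comm: "\<And>k l \<Psi>. Suc k < l \<Longrightarrow> l < n \<Longrightarrow> \<Psi> \<in> flags P \<Longrightarrow> \<rho> k (\<rho> l \<Psi>) = \<rho> l (\<rho> k \<Psi>)"
    and image: "\<And>i g. i \<in> {1..n - 1} \<Longrightarrow> g \<in> carrier (aut_group P) \<Longrightarrow>
      (x i \<otimes>\<^bsub>aut_group P\<^esub> g) ` base P = \<rho> (i - 1) (\<rho> i (g ` base P))"
    and "r \<in> Wplus_relators n"
  shows "word_val (aut_group P) x r = \<one>\<^bsub>aut_group P\<^esub>"
proof -
  interpret group "aut_group P" by (rule group_aut_group)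
  define \<pi> where "\<pi> i j = map (\<lambda>m. (m, True)) [i..<Suc j]" for i j :: nat
  have \<pi>_words: "\<pi> i j \<in> words {1..n - 1}" if "1 \<le> i" "j \<le> n - 1" for i j
    using that by (auto simp: \<pi>_def words_def)
  \<comment> \<open>The tail \<open>w\<close> is carried along so that both halves of a relator
    \<open>\<pi> i j @ \<pi> i j\<close> can be treated. The induction descends from
    \<open>j\<close> and cancels one pair of equal adjacencies per letter.\<close>
  have \<pi>: "word_val (aut_group P) x (\<pi> i j @ w) ` base P
      = \<rho> (i - 1) (\<rho> j (word_val (aut_group P) x w ` base P))"
    if w: "w \<in> words {1..n - 1}" and "1 \<le> i" "i \<le> j" "j \<le> n - 1" for i j w
    using that(3,2)
  proof (induction rule: inc_induct)
    case base
    then show ?case using that image word_val_closed[OF x w] by (simp add: \<pi>_def)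
  next
    case (step m)
    have m: "m \<in> {1..n - 1}" using step that by auto
    define \<Psi> where "\<Psi> = \<rho> j (word_val (aut_group P) x w ` base P)"
    have \<Psi>: "\<Psi> \<in> flags P"
      unfolding \<Psi>_def using that step.hyps by (intro flag aut_flag word_val_closed[OF x w] base_flag) auto
    have "\<pi> m j = (m, True) # \<pi> (Suc m) j" using step by (simp add: \<pi>_def upt_conv_Cons)
    moreover have "word_val (aut_group P) x (\<pi> (Suc m) j @ w) \<in> carrier (aut_group P)"
      using \<pi>_words[of "Suc m" j] that w by (intro word_val_closed[OF x]) auto
    ultimately have "word_val (aut_group P) x (\<pi> m j @ w) ` base P
        = \<rho> (m - 1) (\<rho> m (\<rho> m \<Psi>))"
      using image[OF m] step.IH by (simp add: \<Psi>_def)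
    also have "\<rho> m (\<rho> m \<Psi>) = \<Psi>" using m by (intro invol \<Psi>) auto
    finally show ?case by (simp add: \<Psi>_def)
  qed
  obtain i j where ij: "1 \<le> i" "i < j" "j \<le> n - 1" and r: "r = \<pi> i j @ \<pi> i j"
    using assms(6) by (auto simp: Wplus_relators_def \<pi>_def)
  have w: "\<pi> i j \<in> words {1..n - 1}" using \<pi>_words ij by simp
  define \<Psi> where "\<Psi> = \<rho> j (base P)"
  have \<Psi>: "\<Psi> \<in> flags P" using flag base_flag ij by (simp add: \<Psi>_def)
  have "word_val (aut_group P) x (\<pi> i j) ` base P = \<rho> (i - 1) (\<rho> j (base P))"
    using \<pi>[of "[]" i j] ij image_one_aut_group[OF flag_faces[OF base_flag]] by simp
  then have "word_val (aut_group P) x r ` base P = \<rho> (i - 1) (\<rho> j (\<rho> (i - 1) \<Psi>))"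
    unfolding r using \<pi>[OF w, of i j] ij by (simp add: \<Psi>_def)
  also have "\<rho> j (\<rho> (i - 1) \<Psi>) = \<rho> (i - 1) (\<rho> j \<Psi>)"
    using comm[of "i - 1" j \<Psi>] \<Psi> ij by simp
  also have "\<rho> (i - 1) (\<rho> (i - 1) (\<rho> j \<Psi>)) = \<rho> j \<Psi>"
    using invol[of "i - 1" "\<rho> j \<Psi>"] flag[of j \<Psi>] \<Psi> ij by simp
  also have "\<rho> j \<Psi> = base P" using invol[OF _ base_flag, of j] ij by (simp add: \<Psi>_def)
  finally have "word_val (aut_group P) x r ` base P = \<one>\<^bsub>aut_group P\<^esub> ` base P"
    using image_one_aut_group[OF flag_faces[OF base_flag]] by simp
  then show ?thesis
    using w r by (intro aut_eqI[OF word_val_closed[OF x] one_closed base_flag]) simp_all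
qed

lemma rot_gen_relators:
  assumes "r \<in> Wplus_relators n"
  shows "word_val (aut_group P) (rot_gen P) r = \<one>\<^bsub>aut_group P\<^esub>"
proof (rule Wplus_relators_word_val[OF rot_gen_funcset _ _ _ _ assms,
      where \<rho> = "\<lambda>k. adj_flag P (int k)"])
  fix i g assume "i \<in> {1..n - 1}" "g \<in> carrier (aut_group P)"
  then show "(rot_gen P i \<otimes>\<^bsub>aut_group P\<^esub> g) ` base P
      = adj_flag P (int (i - 1)) (adj_flag P (int i) (g ` base P))"
    using rot_gen_mult_image[of i g] by (simp add: of_nat_diff)
qed (rule adj_flag_flag adj_flag_involution adj_flag_commute; simp)+

section \<open>Rotations of the dual and of the mirror image\<close>

lemma aut_group_dual: "aut_group (dual_polytope n P) = aut_group P"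
  by (auto simp: aut_group_def dual_polytope_def)

lemma aut_group_mirror: "aut_group (mirror_image P) = aut_group P"
  by (simp add: aut_group_def mirror_image_def)

lemma adj_flag_dual: "adj_flag (dual_polytope n P) j \<Phi> = adj_flag P (int n - 1 - j) \<Phi>"
proof -
  have "Chains (converse (face_le P)) = Chains (face_le P)" by (auto simp: Chains_def)
  moreover have "int n - 1 - face_rank P F \<noteq> j \<longleftrightarrow> face_rank P F \<noteq> int n - 1 - j" for F by auto
  ultimately show ?thesis by (simp add: adj_flag_def flags_def dual_polytope_def)
qed

lemma adj_flag_mirror: "adj_flag (mirror_image P) j \<Phi> = adj_flag P j \<Phi>"
  by (simp add: adj_flag_def flags_def mirror_image_def)

text \<open>Reflecting ranks turns the adjacency at i followed by that at i - 1 into those at n - 1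
  - i and then n - i, which is how the inverse of \<open>rot_gen P (n - i)\<close> moves the base
  flag. This is the automorphism delta on generators.\<close>

lemma rot_gen_dual:
  assumes i: "i \<in> {1..n - 1}"
  shows "rot_gen (dual_polytope n P) i = inv\<^bsub>aut_group P\<^esub> rot_gen P (n - i)"
proof -
  interpret group "aut_group P" by (rule group_aut_group)
  have ni: "n - i \<in> {1..n - 1}" and ranks: "int (n - i) = int n - int i" using i by auto
  have "(inv\<^bsub>aut_group P\<^esub> rot_gen P (n - i)) ` base P
      = adj_flag P (int n - int i) (adj_flag P (int n - 1 - int i) (base P))"
    using inv_rot_gen_mult_image[OF ni one_closed] rot_gen_closed[OF ni]
      image_one_aut_group[OF flag_faces[OF base_flag]] unfolding ranks by (simp add: algebra_simps)
  moreover have "inv\<^bsub>aut_group P\<^esub> rot_gen P (n - i) \<in> carrier (aut_group P)"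
    using rot_gen_closed[OF ni] by simp
  moreover have "base (dual_polytope n P) = base P" by (simp add: dual_polytope_def)
  ultimately show ?thesis
    unfolding rot_gen_def aut_group_dual adj_flag_dual
    using aut_eqI[OF _ _ base_flag] by (intro the_equality) (auto simp: algebra_simps)
qed

lemma rot_gen_dual_funcset: "rot_gen (dual_polytope n P) \<in> {1..n - 1} \<rightarrow> carrier (aut_group P)"
proof
  interpret group "aut_group P" by (rule group_aut_group)
  fix i assume i: "i \<in> {1..n - 1}"
  then have "n - i \<in> {1..n - 1}" by auto
  then show "rot_gen (dual_polytope n P) i \<in> carrier (aut_group P)"
    using rot_gen_dual[OF i] rot_gen_closed by simp
qed

lemma rot_gen_dual_relators:
  assumes "r \<in> Wplus_relators n"
  shows "word_val (aut_group P) (rot_gen (dual_polytope n P)) r = \<one>\<^bsub>aut_group P\<^esub>"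
proof (rule Wplus_relators_word_val[OF rot_gen_dual_funcset _ _ _ _ assms,
      where \<rho> = "\<lambda>k. adj_flag P (int n - 1 - int k)"])
  fix i g assume i: "i \<in> {1..n - 1}" and g: "g \<in> carrier (aut_group P)"
  have ni: "n - i \<in> {1..n - 1}"
    and ranks: "int (n - i) - 1 = int n - 1 - int i" "int (n - i) = int n - 1 - int (i - 1)"
    using i by auto
  show "(rot_gen (dual_polytope n P) i \<otimes>\<^bsub>aut_group P\<^esub> g) ` base P
      = adj_flag P (int n - 1 - int (i - 1)) (adj_flag P (int n - 1 - int i) (g ` base P))"
    using inv_rot_gen_mult_image[OF ni g] by (simp only: rot_gen_dual[OF i] flip: ranks)
qed (rule adj_flag_flag adj_flag_involution adj_flag_commute; simp)+

lemma bar_gen_funcset: "bar_gen \<in> {1..n - 1} \<rightarrow> words {1..n - 1}"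
  by (auto simp: bar_gen_def)

text \<open>\<open>bar_gen\<close> is the change of base flag to its 0-adjacent flag, written in the
  old rotations. Automorphisms commute with the 0-adjacency, so it suffices to follow the old base
  flag and apply that adjacency afterwards.\<close>

lemma rot_gen_mirror:
  assumes i: "i \<in> {1..n - 1}"
  shows "rot_gen (mirror_image P) i = word_val (aut_group P) (rot_gen P) (bar_gen i)"
proof -
  interpret group "aut_group P" by (rule group_aut_group)
  define f where "f = word_val (aut_group P) (rot_gen P) (bar_gen i)"
  let ?r = "adj_flag P" and ?B = "base P"
  have one: "\<one>\<^bsub>aut_group P\<^esub> ` ?B = ?B" by (rule image_one_aut_group[OF flag_faces[OF base_flag]])
  have f: "f \<in> carrier (aut_group P)"
    unfolding f_def using bar_gen_funcset i by (intro word_val_closed[OF rot_gen_funcset]) auto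
  have i': "1 \<in> {1..n - 1}" "int i \<in> {0..<int n}" "int i - 1 \<in> {0..<int n}" "0 \<in> {0..<int n}"
    "1 \<in> {0..<int n}"
    using i by auto
  have fl: "?r j \<Psi> \<in> flags P" if "\<Psi> \<in> flags P" "j \<in> {0..<int n}" for j \<Psi>
    using adj_flag_flag[OF that] .
  have "?r 0 (f ` ?B) = ?r (int i - 1) (?r (int i) (?r 0 ?B))"
  proof -
    consider "i = 1" | "i = 2" | "i \<ge> 3" using i by force
    then show ?thesis
    proof cases
      case 1
      then have "f ` ?B = ?r 1 (?r 0 ?B)"
        using inv_rot_gen_mult_image[OF i'(1) one_closed] one rot_gen_closed[OF i'(1)]
        by (simp add: f_def bar_gen_def)
      then show ?thesis using 1 by simp
    next
      case 2
      have g: "rot_gen P 2 \<in> carrier (aut_group P)" using rot_gen_closed[OF i] 2 by simp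
      have r2: "?r 2 ?B \<in> flags P" using fl[OF base_flag i'(2)] 2 by simp
      have "f = rot_gen P 1 \<otimes>\<^bsub>aut_group P\<^esub> (rot_gen P 1 \<otimes>\<^bsub>aut_group P\<^esub> rot_gen P 2)"
        using g by (simp add: f_def bar_gen_def 2)
      \<comment> \<open>Read from the outside, the three factors contribute the ranks 0 1, 0 1 and 1
        2. The two adjacent 1s cancel; a further 0 in front cancels the leading one and leaves 1 0
        2, where 0 commutes with 2.\<close>
      then have "f ` ?B = ?r 0 (?r 1 (?r 0 (?r 1 (?r 1 (?r 2 ?B)))))"
        using rot_gen_mult_image[OF i'(1)] g rot_gen_closed[OF i'(1)] rot_gen_base[OF i] 2 by simp
      also have "?r 1 (?r 1 (?r 2 ?B)) = ?r 2 ?B"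
        by (rule adj_flag_involution[OF r2 i'(5)])
      finally have "?r 0 (f ` ?B) = ?r 1 (?r 0 (?r 2 ?B))"
        using adj_flag_involution[OF fl[OF fl[OF r2 i'(4)] i'(5)] i'(4)] by simp
      also have "?r 0 (?r 2 ?B) = ?r 2 (?r 0 ?B)"
        using i' 2 by (intro adj_flag_commute[OF base_flag]) auto
      finally show ?thesis using 2 by simp
    next
      case 3
      \<comment> \<open>Both ranks involved are now at least 2, so the adjacency at 0 passes through
        them.\<close>
      then have "f = rot_gen P i" using rot_gen_closed[OF i] by (simp add: f_def bar_gen_def)
      then have "?r 0 (f ` ?B) = ?r 0 (?r (int i - 1) (?r (int i) ?B))"
        using rot_gen_base[OF i] by simp
      also have "\<dots> = ?r (int i - 1) (?r 0 (?r (int i) ?B))"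
        using i' 3 by (intro adj_flag_commute fl[OF base_flag]) auto
      also have "?r 0 (?r (int i) ?B) = ?r (int i) (?r 0 ?B)"
        using i' 3 by (intro adj_flag_commute[OF base_flag]) auto
      finally show ?thesis .
    qed
  qed
  then have "f ` ?r 0 ?B = ?r (int i - 1) (?r (int i) (?r 0 ?B))"
    using aut_adj_flag[OF f base_flag i'(4)] by simp
  moreover have "base (mirror_image P) = ?r 0 ?B" by (simp add: mirror_image_def)
  ultimately have fB: "f ` base (mirror_image P) = ?r (int i - 1) (?r (int i) (base (mirror_image P)))"
    and B: "base (mirror_image P) \<in> flags P"
    using fl[OF base_flag i'(4)] by simp_all
  have "rot_gen (mirror_image P) i = f"
    unfolding rot_gen_def aut_group_mirror adj_flag_mirror
  proof (rule the_equality)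
    fix g assume "g \<in> carrier (aut_group P) \<and>
      g ` base (mirror_image P) = ?r (int i - 1) (?r (int i) (base (mirror_image P)))"
    then show "g = f" using aut_eqI[OF _ f B] fB by simp
  qed (use f fB in simp)
  then show ?thesis by (simp add: f_def)
qed

lemma rot_gen_mirror_funcset: "rot_gen (mirror_image P) \<in> {1..n - 1} \<rightarrow> carrier (aut_group P)"
  using rot_gen_mirror bar_gen_funcset group.word_val_closed[OF group_aut_group rot_gen_funcset]
  by (auto simp: Pi_iff)

lemma generate_rot_gen_dual_subset:
  "generate (aut_group P) (rot_gen (dual_polytope n P) ` {1..n - 1})
    \<subseteq> generate (aut_group P) (rot_gen P ` {1..n - 1})"
proof (rule group.generate_subgroup_incl[OF group_aut_group])
  show "subgroup (generate (aut_group P) (rot_gen P ` {1..n - 1})) (aut_group P)"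
    using rot_gen_funcset by (intro group.generate_is_subgroup[OF group_aut_group]) auto
  show "rot_gen (dual_polytope n P) ` {1..n - 1} \<subseteq> generate (aut_group P) (rot_gen P ` {1..n - 1})"
  proof clarify
    fix i assume i: "i \<in> {1..n - 1}"
    then have "n - i \<in> {1..n - 1}" by auto
    then show "rot_gen (dual_polytope n P) i \<in> generate (aut_group P) (rot_gen P ` {1..n - 1})"
      unfolding rot_gen_dual[OF i] by (intro generate.inv imageI)
  qed
qed

text \<open>The bar substitution undoes itself: the old rotations are words of the same shape in the
  new ones. Combined with the previous inclusion, this bounds the subgroup generated for the dual by
  the one generated for the mirror image.\<close>

lemma generate_rot_gen_subset_mirror:
  "generate (aut_group P) (rot_gen P ` {1..n - 1})
    \<subseteq> generate (aut_group P) (rot_gen (mirror_image P) ` {1..n - 1})" (is "_ \<subseteq> ?V")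
proof (rule group.generate_subgroup_incl[OF group_aut_group])
  interpret group "aut_group P" by (rule group_aut_group)
  show "subgroup ?V (aut_group P)"
    using rot_gen_mirror_funcset by (intro generate_is_subgroup) auto
  show "rot_gen P ` {1..n - 1} \<subseteq> ?V"
  proof clarify
    fix i assume i: "i \<in> {1..n - 1}"
    let ?\<mu> = "rot_gen (mirror_image P)"
    have mem: "?\<mu> j \<in> ?V" if "j \<in> {1..n - 1}" for j using that by (intro generate.incl imageI)
    have one: "1 \<in> {1..n - 1}" using i by auto
    have c1: "rot_gen P 1 \<in> carrier (aut_group P)" by (rule rot_gen_closed[OF one])
    have \<mu>1: "?\<mu> 1 = inv\<^bsub>aut_group P\<^esub> rot_gen P 1"
      using rot_gen_mirror[OF one] c1 by (simp add: bar_gen_def)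
    consider "i = 1" | "i = 2" | "i \<ge> 3" using i by force
    then show "rot_gen P i \<in> ?V"
    proof cases
      case 1
      have "inv\<^bsub>aut_group P\<^esub> ?\<mu> 1 \<in> ?V" using one by (intro generate.inv imageI)
      then show ?thesis using \<mu>1 c1 1 by simp
    next
      case 2
      have c2: "rot_gen P 2 \<in> carrier (aut_group P)" using rot_gen_closed[OF i] 2 by simp
      have "?\<mu> 2 = rot_gen P 1 \<otimes>\<^bsub>aut_group P\<^esub> (rot_gen P 1 \<otimes>\<^bsub>aut_group P\<^esub> rot_gen P 2)"
        using rot_gen_mirror[OF i] 2 c2 by (simp add: bar_gen_def)
      then have "?\<mu> 1 \<otimes>\<^bsub>aut_group P\<^esub> (?\<mu> 1 \<otimes>\<^bsub>aut_group P\<^esub> ?\<mu> 2) = rot_gen P 2"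
        using c1 c2 \<mu>1 by (simp add: inv_solve_left' flip: m_assoc)
      then show ?thesis
        using generate.eng[OF mem[OF one] generate.eng[OF mem[OF one] mem[OF i]]] 2 by simp
    next
      case 3
      then have "?\<mu> i = rot_gen P i"
        using rot_gen_mirror[OF i] rot_gen_closed[OF i] by (simp add: bar_gen_def)
      then show ?thesis using mem[OF i] by simp
    qed
  qed
qed

end

section \<open>Chirality of the mix\<close>

lemma word_val_cong:
  assumes "\<And>x. x \<in> X \<Longrightarrow> f x = g x" "w \<in> words X"
  shows "word_val G f w = word_val G g w"
  using assms(2) by (induction w) (use assms(1) in auto)

lemma word_val_DirProd:
  assumes "group G" "group H" "x \<in> X \<rightarrow> carrier G" "y \<in> X \<rightarrow> carrier H" "w \<in> words X"
  shows "word_val (G \<times>\<times> H) (\<lambda>i. (x i, y i)) w = (word_val G x w, word_val H y w)"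
proof -
  interpret group "G \<times>\<times> H" using assms by (intro DirProd_group)
  have f: "(\<lambda>i. (x i, y i)) \<in> X \<rightarrow> carrier (G \<times>\<times> H)" using assms by auto
  have "fst \<in> hom (G \<times>\<times> H) G" "snd \<in> hom (G \<times>\<times> H) H" by (auto simp: hom_def)
  then show ?thesis
    using word_val_hom[OF assms(1) _ f assms(5), of fst] word_val_hom[OF assms(2) _ f assms(5), of snd]
    by (simp add: prod_eq_iff)
qed

text \<open>When common relators of \<open>x\<close> and \<open>y\<close> are relators of
  \<open>z\<close>, the values of a word under \<open>x\<close> and \<open>y\<close> determine its
  value under \<open>z\<close>. The pairs for \<open>x\<close> and \<open>y\<close> therefore map
  onto those for \<open>x\<close> and \<open>z\<close>.\<close>

lemma card_pairs_le_of_relators: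
  fixes k :: nat
  assumes "group G" "group H" "group K" "finite (carrier G)" "finite (carrier H)"
    and x: "x \<in> {1..k} \<rightarrow> carrier G" and y: "y \<in> {1..k} \<rightarrow> carrier H" and z: "z \<in> {1..k} \<rightarrow> carrier K"
    and sub: "relators k G x \<inter> relators k H y \<subseteq> relators k K z"
  shows "card ((\<lambda>w. (word_val G x w, word_val K z w)) ` words {1..k})
    \<le> card ((\<lambda>w. (word_val G x w, word_val H y w)) ` words {1..k})"
proof -
  interpret G: group G by fact
  interpret H: group H by fact
  interpret K: group K by fact
  have eq: "word_val K z u = word_val K z v"
    if u: "u \<in> words {1..k}" and v: "v \<in> words {1..k}"
      and "word_val G x u = word_val G x v" "word_val H y u = word_val H y v" for u v
  proof -
    have "inv_word v @ u \<in> relators k G x \<inter> relators k H y"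
      using that G.word_val_append[OF x, of "inv_word v" u] G.word_val_inv_word[OF x v]
        H.word_val_append[OF y, of "inv_word v" u] H.word_val_inv_word[OF y v]
        G.word_val_closed[OF x v] H.word_val_closed[OF y v]
      by (simp add: relators_def)
    then have "inv_word v @ u \<in> relators k K z" using sub by blast
    then have "word_val K z (inv_word v @ u) = \<one>\<^bsub>K\<^esub>" by (simp add: relators_def)
    then have "inv\<^bsub>K\<^esub> word_val K z v \<otimes>\<^bsub>K\<^esub> word_val K z u = \<one>\<^bsub>K\<^esub>"
      using K.word_val_append[OF z, of "inv_word v" u] K.word_val_inv_word[OF z v] u v by simp
    then have "inv\<^bsub>K\<^esub> word_val K z u = inv\<^bsub>K\<^esub> word_val K z v"
      using K.word_val_closed[OF z] u v by (intro K.inv_equality) auto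
    from inj_onD[OF K.inv_inj this] K.word_val_closed[OF z] u v show ?thesis by blast
  qed
  define c where "c p = (SOME w. w \<in> words {1..k} \<and> (word_val G x w, word_val H y w) = p)" for p
  let ?M = "(\<lambda>w. (word_val G x w, word_val H y w)) ` words {1..k}"
  have "(\<lambda>w. (word_val G x w, word_val K z w)) ` words {1..k}
      \<subseteq> (\<lambda>p. (fst p, word_val K z (c p))) ` ?M"
  proof clarify
    fix w assume w: "w \<in> words {1..k}"
    let ?p = "(word_val G x w, word_val H y w)"
    have "c ?p \<in> words {1..k} \<and> (word_val G x (c ?p), word_val H y (c ?p)) = ?p"
      unfolding c_def
      by (rule someI[of "\<lambda>v. v \<in> words {1..k} \<and> (word_val G x v, word_val H y v) = ?p" w])
        (use w in simp)
    then have "word_val K z (c ?p) = word_val K z w" using eq w by blast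
    then show "(word_val G x w, word_val K z w) \<in> (\<lambda>p. (fst p, word_val K z (c p))) ` ?M"
      using w by (intro image_eqI[of _ _ ?p]) auto
  qed
  moreover have "?M \<subseteq> carrier G \<times> carrier H"
    using G.word_val_closed[OF x] H.word_val_closed[OF y] by auto
  then have "finite ?M" using assms(4,5) finite_subset by blast
  ultimately show ?thesis by (rule surj_card_le[rotated])
qed

lemma (in group) card_generate_pos:
  assumes "finite (carrier G)" "f \<in> X \<rightarrow> carrier G"
  shows "0 < card (generate G (f ` X))"
proof -
  have "generate G (f ` X) \<subseteq> carrier G" using assms(2) by (intro generate_incl) auto
  then have "finite (generate G (f ` X))" using assms(1) finite_subset by blast
  moreover have "\<one> \<in> generate G (f ` X)" by (rule generate.one)
  ultimately show ?thesis by (auto simp: card_gt_0_iff)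
qed

text \<open>With g the order of the subgroup generated by \<open>x\<close>, the comixes have orders
  g / a and g / b, and the mixes have orders \<open>a * |<y>|\<close> and \<open>b * |<z>|\<close>.
  Comparing the mixes and using \<open>|<y>| \<le> |<z>|\<close> yields \<open>b \<le> a\<close>;
  finiteness makes the factors positive, so that they cancel.\<close>

lemma order_comix_le_of_relators:
  fixes k :: nat
  assumes "group G" "group H" "group K"
    and fin: "finite (carrier G)" "finite (carrier H)" "finite (carrier K)"
    and x: "x \<in> {1..k} \<rightarrow> carrier G" and y: "y \<in> {1..k} \<rightarrow> carrier H" and z: "z \<in> {1..k} \<rightarrow> carrier K"
    and sub: "relators k G x \<inter> relators k H y \<subseteq> relators k K z"
    and card: "card (generate H (y ` {1..k})) \<le> card (generate K (z ` {1..k}))"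
  shows "order (comix k G x H y) \<le> order (comix k G x K z)"
proof -
  define a where "a = card (word_val G x ` relators k H y)"
  define b where "b = card (word_val G x ` relators k K z)"
  define v where "v = card (generate K (z ` {1..k}))"
  have pos: "0 < card (generate G (x ` {1..k}))" "0 < v"
    unfolding v_def using assms by (auto intro!: group.card_generate_pos)
  have a: "order (comix k G x H y) * a = card (generate G (x ` {1..k}))"
    unfolding a_def by (rule order_comix[OF assms(1,2) x y])
  have b: "order (comix k G x K z) * b = card (generate G (x ` {1..k}))"
    unfolding b_def by (rule order_comix[OF assms(1,3) x z])
  have "b * v \<le> a * card (generate H (y ` {1..k}))"
    using card_pairs_le_of_relators[OF assms(1-3) fin(1,2) x y z sub]
    by (simp only: card_word_val_pairs[OF assms(1,2) x y] card_word_val_pairs[OF assms(1,3) x z]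
        a_def b_def v_def)
  also have "\<dots> \<le> a * v" using card by (simp add: v_def)
  finally have "b \<le> a" using pos(2) by simp
  then have "order (comix k G x H y) * a \<le> order (comix k G x K z) * a"
    unfolding a b[symmetric] by simp
  moreover have "0 < a" using pos(1) unfolding a[symmetric] by simp
  ultimately show ?thesis by simp
qed

theorem proposition5p2:
  fixes P :: "'a based_poset" and n :: nat
  assumes "abstract_polytope n P"
    and "finite (faces P)"
    and "chiral P"
    and "order (comix (n - 1) (rot_group P) (rot_gen P)
                  (rot_group (dual_polytope n P)) (rot_gen (dual_polytope n P)))
       > order (comix (n - 1) (rot_group P) (rot_gen P)
                  (rot_group (mirror_image P)) (rot_gen (mirror_image P)))"
  shows "mix_chiral n P (dual_polytope n P)"
proof -
  interpret finite_chiral_polytope n P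
    using assms by unfold_locales
  define G where "G = aut_group P"
  define X where "X = {1..n - 1}"
  define x where "x = rot_gen P"
  define y where "y = rot_gen (dual_polytope n P)"
  define z where "z = rot_gen (mirror_image P)"
  define D where "D = mix (n - 1) G x G y"
  interpret G: group G unfolding G_def by (rule group_aut_group)
  interpret GG: group "G \<times>\<times> G" by (intro DirProd_group G.is_group)
  interpret D: group D unfolding D_def mix_def by simp
  have x: "x \<in> X \<rightarrow> carrier G" and y: "y \<in> X \<rightarrow> carrier G" and z: "z \<in> X \<rightarrow> carrier G"
    using rot_gen_funcset rot_gen_dual_funcset rot_gen_mirror_funcset
    by (simp_all add: G_def X_def x_def y_def z_def)
  have fin: "finite (carrier G)" unfolding G_def by (rule finite_carrier_aut_group[OF assms(2)])
  define f where "f = (\<lambda>i. (x i, y i))"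
  have fX: "f \<in> X \<rightarrow> carrier (G \<times>\<times> G)" using x y by (auto simp: f_def)
  have D: "D = subgroup_generated (G \<times>\<times> G) (f ` X)"
    unfolding D_def mix_def f_def X_def ..
  have fD: "f ` X \<subseteq> carrier D"
    unfolding D using fX
    by (intro GG.subgroup_generated_subset_carrier_subset) (simp add: image_subset_iff_funcset)
  have gen: "generate D (f ` X) = carrier D"
    using fD GG.subgroup_generated2[of "f ` X"] carrier_subgroup_generated[of D "f ` X"]
    by (simp add: Int_absorb1 flip: D)
  have val: "word_val D f w = (word_val G x w, word_val G y w)" if "w \<in> words X" for w
    using GG.word_val_subgroup_generated[OF fX subset_refl that, folded D]
      word_val_DirProd[OF G.is_group G.is_group x y that, folded f_def] by simp
  have one: "\<one>\<^bsub>D\<^esub> = (\<one>\<^bsub>G\<^esub>, \<one>\<^bsub>G\<^esub>)" by (simp add: D)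
  \<comment> \<open>Both components satisfy the relations of \<open>Wplus\<close>, so von Dyck's
    theorem gives the epimorphism onto the mix; its kernel is the witness that
    \<open>mix_chiral\<close> asks for.\<close>
  have "word_val D f r = \<one>\<^bsub>D\<^esub>" if "r \<in> Wplus_relators n" "r \<in> words X" for r
    using val[OF that(2)] one rot_gen_relators[OF that(1)] rot_gen_dual_relators[OF that(1)]
    by (simp add: G_def x_def y_def)
  from D.presented_group_epi[OF fD[unfolded image_subset_iff_funcset] gen this]
  obtain h where h: "h \<in> epi (Wplus n) D"
    and h_val: "\<And>w. w \<in> words X \<Longrightarrow> h (Wplus_class n w) = word_val D f w"
    unfolding Wplus_def Wplus_class_def X_def by blast
  define N where "N = kernel (Wplus n) D h"
  have "h (Wplus_class n [(i, True)]) = f i" if "i \<in> X" for i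
  proof -
    have "f i \<in> carrier D" using fD that by blast
    then show ?thesis using h_val[of "[(i, True)]"] that by simp
  qed
  then have quot: "is_Wplus_quotient n D f N"
    unfolding is_Wplus_quotient_def N_def X_def by (intro bexI[OF _ h]) simp
  have car: "carrier (Wplus n) = Wplus_class n ` words X"
    by (auto simp: Wplus_def Wplus_class_def presented_group_def quotient_def X_def)
  have N: "Wplus_class n w \<in> N \<longleftrightarrow> word_val G x w = \<one>\<^bsub>G\<^esub> \<and> word_val G y w = \<one>\<^bsub>G\<^esub>"
    if "w \<in> words X" for w
    using that h_val val one by (auto simp: N_def kernel_def car)
  have "bar n ` N \<noteq> N"
  proof
    assume bar: "bar n ` N = N"
    have "relators (n - 1) G x \<inter> relators (n - 1) G y \<subseteq> relators (n - 1) G z"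
    proof
      fix w assume "w \<in> relators (n - 1) G x \<inter> relators (n - 1) G y"
      then have w: "w \<in> words X" "word_val G x w = \<one>\<^bsub>G\<^esub>" "word_val G y w = \<one>\<^bsub>G\<^esub>"
        by (auto simp: relators_def X_def)
      define v where "v = subst_word bar_gen w"
      have v: "v \<in> words X"
        unfolding v_def X_def by (rule subst_word_in_words[OF bar_gen_funcset w(1)[unfolded X_def]])
      have self: "u \<in> Wplus_class n u" if "u \<in> words X" for u
        using that by (simp add: Wplus_class_def X_def pres_rel.refl)
      \<comment> \<open>\<open>bar\<close> is a union over representatives, so its value here
        contains \<open>v\<close>. Lying in \<open>N\<close>, that value is itself a class, namely
        the class of \<open>v\<close>.\<close>
      have "v \<in> bar n (Wplus_class n w)"
        unfolding bar_def using self[OF w(1)] self[OF v] v_def by blast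
      moreover have "bar n (Wplus_class n w) \<in> N" using N w bar by blast
      moreover from this obtain u where u: "u \<in> words X" "bar n (Wplus_class n w) = Wplus_class n u"
        unfolding N_def kernel_def car by blast
      ultimately have "(u, v) \<in> pres_rel {1..n - 1} (Wplus_relators n)" "Wplus_class n u \<in> N"
        by (simp_all add: Wplus_class_def)
      then have "Wplus_class n v \<in> N"
        using equiv_class_eq[OF equiv_pres_rel] unfolding Wplus_class_def by metis
      then have "word_val G x v = \<one>\<^bsub>G\<^esub>" using N[OF v] by simp
      \<comment> \<open>Evaluating the words \<open>bar_gen i\<close> at the rotations of
        \<open>P\<close> gives the generators of the mirror image, so \<open>v\<close> at
        \<open>x\<close> is \<open>w\<close> at \<open>z\<close>.\<close>
      moreover have "word_val G x v = word_val G (\<lambda>i. word_val G x (bar_gen i)) w"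
        unfolding v_def by (rule G.word_val_subst_word[OF x bar_gen_funcset[folded X_def] w(1)])
      moreover have "\<dots> = word_val G z w"
        by (rule word_val_cong[OF _ w(1)]) (simp add: rot_gen_mirror X_def x_def z_def G_def)
      ultimately show "w \<in> relators (n - 1) G z" using w(1) by (simp add: relators_def X_def)
    qed
    \<comment> \<open>The subgroup generated for the dual lies in the one for \<open>P\<close>,
      which lies in the one for the mirror image.\<close>
    moreover have "card (generate G (y ` X)) \<le> card (generate G (z ` X))"
    proof (rule card_mono)
      show "finite (generate G (z ` X))"
        using z by (intro finite_subset[OF G.generate_incl fin]) (simp add: image_subset_iff_funcset)
      show "generate G (y ` X) \<subseteq> generate G (z ` X)"
        using subset_trans[OF generate_rot_gen_dual_subset generate_rot_gen_subset_mirror]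
        by (simp add: G_def X_def y_def z_def)
    qed
    ultimately have "order (comix (n - 1) G x G y) \<le> order (comix (n - 1) G x G z)"
      by (rule order_comix_le_of_relators[OF G.is_group G.is_group G.is_group fin fin fin
            x[unfolded X_def] y[unfolded X_def] z[unfolded X_def], folded X_def])
    then show False
      using assms(4) by (simp add: aut_group_dual aut_group_mirror G_def x_def y_def z_def)
  qed
  then show ?thesis
    unfolding mix_chiral_def aut_group_dual
    using quot[unfolded D_def f_def G_def x_def y_def] by blast
qed

end
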